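(* There exist absolute constants $C,c>0$ such that the following holds. For all integers $d\ge 1$, $\ell\in\{1,\dots,d\}$, $s\ge 0$ and every $\varepsilon\in(0,1]$, if \[ n\;\ge\; C\cdot\frac{d}{\ell\varepsilon^2}\cdot\sqrt{\max\left(\frac{d}{2^{cs}},\,\ell\right)}, \] then there exists a protocol $\Pi$ for distributed Gaussian mean testing in dimension $d$ with threshold $\varepsilon$, in which $n$ users each hold exactly one sample ($m_k=1$), each sends $\ell_k=\ell$ bits, and the users share $s$ bits of public randomness, such that $\delta(\Pi)\le 1/10$.
   Context: Distributed Gaussian mean testing. Let $\mathcal{G}(\bm{\mu},\mathbb{I}_d)$ denote the $d$-dimensional Gaussian with mean $\bm{\mu}\in\mathbb{R}^d$ and identity covariance. For a threshold $\varepsilon\in(0,1]$, let $\mathcal{H}_0=\{\mathcal{G}(\bm 0,\mathbb{I}_d)\}$ and $\mathcal{H}_1=\{\mathcal{G}(\bm\mu,\mathbb{I}_d):\|\bm\mu\|_2\ge\varepsilon\}$. There are $n$ users and a referee; an unknown $G\in\mathcal{H}_0\cup\mathcal{H}_1$ is fixed. User $k\in[n]$ observes $m_k\ge1$ i.i.d. samples $X^{(k)}=(\bm X^{(k,1)},\dots,\bm X^{(k,m_k)})$ from $G$ (independent across users) and sends the message $\bm Y^{(k)}=W^{(k)}(X^{(k)})\in\{0,1\}^{\ell_k}$, where the encoding functions $W^{(k)}:\mathbb{R}^{d m_k}\to\{0,1\}^{\ell_k}$ may be randomized using $s\ge0$ uniformly random bits shared by all users (public randomness, used to jointly sample the tuple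 $(W^{(1)},\dots,W^{(n)})$) together with arbitrary private randomness independent across users. The referee applies a test $T:\{0,1\}^{\ell_1}\times\cdots\times\{0,1\}^{\ell_n}\to\{0,1\}$ to $(\bm Y^{(1)},\dots,\bm Y^{(n)})$ and accepts $\mathcal{H}_0$ iff the output is $0$. For the protocol $\Pi=((W^{(k)})_k,T)$, the error is $\delta(\Pi)=\max\left(\sup_{G\in\mathcal{H}_0}\Pr[T=1],\ \sup_{G\in\mathcal{H}_1}\Pr[T=0]\right)$. *)

theory Defs
  imports "HOL-Probability.Probability"
begin

text \<open>Vectors of dimension d are functions on the index set \<open>{..<d}\<close>, so that d can be an
  ordinary natural number. With identity covariance the coordinates are independent normals
  of variance 1.\<close>

definition std_gaussian :: "nat \<Rightarrow> (nat \<Rightarrow> real) \<Rightarrow> (nat \<Rightarrow> real) measure" where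
  "std_gaussian d \<mu> = (\<Pi>\<^sub>M i\<in>{..<d}. density lborel (\<lambda>t. ennreal (normal_density (\<mu> i) 1 t)))"

definition null_hyp :: "nat \<Rightarrow> (nat \<Rightarrow> real) measure set" where
  "null_hyp d = {std_gaussian d (\<lambda>_. 0)}"

definition alt_hyp :: "nat \<Rightarrow> real \<Rightarrow> (nat \<Rightarrow> real) measure set" where
  "alt_hyp d \<epsilon> = {std_gaussian d \<mu> | \<mu>. L2_set \<mu> {..<d} \<ge> \<epsilon>}"

text \<open>Users are numbered \<open>0, ..., n - 1\<close>. User k draws a private seed u from \<open>private_seed P k\<close>
  and, on the public bit string r and its samples x (\<open>x j\<close> is the j-th sample), sends
  \<open>encoder P k r u x\<close>. The referee's test sees the family of messages only, neither the public
  nor the private randomness; the output \<open>True\<close> stands for 1, i.e. for rejecting the null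
  hypothesis.\<close>

record 'w protocol =
  private_seed :: "nat \<Rightarrow> 'w measure"
  encoder :: "nat \<Rightarrow> bool list \<Rightarrow> 'w \<Rightarrow> (nat \<Rightarrow> nat \<Rightarrow> real) \<Rightarrow> bool list"
  referee_test :: "(nat \<Rightarrow> bool list) \<Rightarrow> bool"

definition samples_space :: "nat \<Rightarrow> nat \<Rightarrow> (nat \<Rightarrow> nat \<Rightarrow> real) measure" where
  "samples_space d m = (\<Pi>\<^sub>M j\<in>{..<m}. \<Pi>\<^sub>M i\<in>{..<d}. borel)"

definition is_protocol ::
    "nat \<Rightarrow> nat \<Rightarrow> (nat \<Rightarrow> nat) \<Rightarrow> (nat \<Rightarrow> nat) \<Rightarrow> nat \<Rightarrow> 'w protocol \<Rightarrow> bool" where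
  "is_protocol d n m L s P \<longleftrightarrow>
     (\<forall>k<n. prob_space (private_seed P k) \<and>
        (\<forall>r. length r = s \<longrightarrow>
           (\<lambda>(u, x). encoder P k r u x) \<in>
             private_seed P k \<Otimes>\<^sub>M samples_space d (m k) \<rightarrow>\<^sub>M count_space {y. length y = L k}))"

text \<open>Joint law of public bits, private seeds and samples when every sample has law G.\<close>

definition joint_law ::
    "nat \<Rightarrow> (nat \<Rightarrow> nat) \<Rightarrow> nat \<Rightarrow> 'w protocol \<Rightarrow> (nat \<Rightarrow> real) measure \<Rightarrow>
     (bool list \<times> (nat \<Rightarrow> 'w) \<times> (nat \<Rightarrow> nat \<Rightarrow> nat \<Rightarrow> real)) measure" where
  "joint_law n m s P G =
     uniform_count_measure {r. length r = s} \<Otimes>\<^sub>M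
     ((\<Pi>\<^sub>M k\<in>{..<n}. private_seed P k) \<Otimes>\<^sub>M (\<Pi>\<^sub>M k\<in>{..<n}. \<Pi>\<^sub>M j\<in>{..<m k}. G))"

definition messages ::
    "nat \<Rightarrow> 'w protocol \<Rightarrow> bool list \<times> (nat \<Rightarrow> 'w) \<times> (nat \<Rightarrow> nat \<Rightarrow> nat \<Rightarrow> real) \<Rightarrow>
     nat \<Rightarrow> bool list" where
  "messages n P = (\<lambda>(r, u, x). \<lambda>k\<in>{..<n}. encoder P k r (u k) (x k))"

definition output_prob ::
    "nat \<Rightarrow> (nat \<Rightarrow> nat) \<Rightarrow> nat \<Rightarrow> 'w protocol \<Rightarrow> (nat \<Rightarrow> real) measure \<Rightarrow> bool \<Rightarrow> real" where
  "output_prob n m s P G b =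
     measure (joint_law n m s P G)
       {\<omega> \<in> space (joint_law n m s P G). referee_test P (messages n P \<omega>) = b}"

definition protocol_error ::
    "nat \<Rightarrow> real \<Rightarrow> nat \<Rightarrow> (nat \<Rightarrow> nat) \<Rightarrow> nat \<Rightarrow> 'w protocol \<Rightarrow> real" where
  "protocol_error d \<epsilon> n m s P =
     max (SUP G\<in>null_hyp d. output_prob n m s P G True)
         (SUP G\<in>alt_hyp d \<epsilon>. output_prob n m s P G False)"

text \<open>The error events are measurable, so \<open>output_prob\<close> never measures a set outside the
  sigma-algebra (where \<open>measure\<close> would be 0).\<close>

lemma sets_std_gaussian: "sets (std_gaussian d \<mu>) = sets (\<Pi>\<^sub>M i\<in>{..<d}. borel)"
  unfolding std_gaussian_def by (rule sets_PiM_cong) auto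

lemma prob_space_std_gaussian: "prob_space (std_gaussian d \<mu>)"
  unfolding std_gaussian_def by (rule prob_space_PiM) (simp add: prob_space_normal_density)

lemma finite_bit_strings: "finite {r::bool list. length r = s}"
  using finite_lists_length_eq[of "UNIV :: bool set" s] by simp

lemma prob_space_joint_law:
  assumes "is_protocol d n m L s P" "prob_space G"
  shows "prob_space (joint_law n m s P G)"
proof -
  have 1: "prob_space (\<Pi>\<^sub>M k\<in>{..<n}. private_seed P k)"
    using assms by (intro prob_space_PiM) (auto simp: is_protocol_def)
  have 2: "prob_space (\<Pi>\<^sub>M k\<in>{..<n}. \<Pi>\<^sub>M j\<in>{..<m k}. G)"
    using assms by (intro prob_space_PiM) auto
  have 0: "prob_space (uniform_count_measure {r::bool list. length r = s})"
    using finite_bit_strings Ex_list_of_length[of s]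
    by (intro prob_space_uniform_count_measure) auto
  show ?thesis unfolding joint_law_def
    by (intro prob_space_pair 0 1 2)
qed

lemma measurable_messages:
  assumes Pr: "is_protocol d n m L s P" and G: "sets G = sets (\<Pi>\<^sub>M i\<in>{..<d}. borel)"
  shows "messages n P \<in>
    joint_law n m s P G \<rightarrow>\<^sub>M count_space (PiE {..<n} (\<lambda>k. {y. length y = L k}))"
proof -
  let ?N = "(\<Pi>\<^sub>M k\<in>{..<n}. private_seed P k) \<Otimes>\<^sub>M (\<Pi>\<^sub>M k\<in>{..<n}. \<Pi>\<^sub>M j\<in>{..<m k}. G)"
  let ?D = "PiE {..<n} (\<lambda>k. {y::bool list. length y = L k})"
  have S: "sets (\<Pi>\<^sub>M j\<in>{..<m k}. G) = sets (samples_space d (m k))" for k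
    unfolding samples_space_def by (rule sets_PiM_cong) (auto simp: G)
  have c: "(\<lambda>w. encoder P k r (fst w k) (snd w k)) \<in> ?N \<rightarrow>\<^sub>M count_space {y. length y = L k}"
    if k: "k < n" and r: "length r = s" for k r
  proof -
    have "(\<lambda>(u, x). encoder P k r u x) \<in>
        private_seed P k \<Otimes>\<^sub>M samples_space d (m k) \<rightarrow>\<^sub>M count_space {y. length y = L k}"
      using Pr k r unfolding is_protocol_def by blast
    then have e: "(\<lambda>(u, x). encoder P k r u x) \<in>
        private_seed P k \<Otimes>\<^sub>M (\<Pi>\<^sub>M j\<in>{..<m k}. G) \<rightarrow>\<^sub>M count_space {y. length y = L k}"
      using measurable_cong_sets[OF sets_pair_measure_cong[OF refl S] refl] by blast
    have "(\<lambda>w. (fst w k, snd w k)) \<in> ?N \<rightarrow>\<^sub>M private_seed P k \<Otimes>\<^sub>M (\<Pi>\<^sub>M j\<in>{..<m k}. G)"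
      using k by (intro measurable_Pair
        measurable_compose[OF measurable_fst measurable_component_singleton]
        measurable_compose[OF measurable_snd
          measurable_component_singleton[where M="\<lambda>k. \<Pi>\<^sub>M j\<in>{..<m k}. G"]]) auto
    from measurable_compose[OF this e] show ?thesis by simp
  qed
  have fin: "finite ?D" by (intro finite_PiE) (auto simp: finite_bit_strings)
  have r: "(\<lambda>w. messages n P (r, w)) \<in> ?N \<rightarrow>\<^sub>M count_space ?D" if r: "length r = s" for r
  proof (rule measurable_count_space_eq2[THEN iffD2, OF fin], intro conjI ballI)
    show "(\<lambda>w. messages n P (r, w)) \<in> space ?N \<rightarrow> ?D"
      using measurable_space[OF c[OF _ r]] by (auto simp: messages_def split: prod.splits if_splits)
  next
    fix f assume f: "f \<in> ?D"
    have "(\<lambda>w. messages n P (r, w)) -` {f} \<inter> space ?N =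
        {w \<in> space ?N. \<forall>k\<in>{..<n}. encoder P k r (fst w k) (snd w k) = f k}"
      using f by (auto simp: messages_def fun_eq_iff PiE_def extensional_def split: prod.splits)
    also have "\<dots> \<in> sets ?N"
    proof (rule sets.sets_Collect_finite_All)
      fix k assume k: "k \<in> {..<n}"
      have "(\<lambda>w. encoder P k r (fst w k) (snd w k)) -` {f k} \<inter> space ?N \<in> sets ?N"
        using c[of k r] k r f by (intro measurable_sets[OF c[of k r]]) auto
      then show "{w \<in> space ?N. encoder P k r (fst w k) (snd w k) = f k} \<in> sets ?N"
        by (simp add: vimage_def Int_def conj_commute)
    qed simp
    finally show "(\<lambda>w. messages n P (r, w)) -` {f} \<inter> space ?N \<in> sets ?N" .
  qed
  have "(\<lambda>(r, w). messages n P (r, w)) \<in>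
      count_space {r. length r = s} \<Otimes>\<^sub>M ?N \<rightarrow>\<^sub>M count_space ?D"
    using finite_bit_strings r
    by (intro measurable_pair_measure_countable1) (auto intro: countable_finite)
  then show ?thesis unfolding joint_law_def
    using measurable_cong_sets[OF sets_pair_measure_cong[OF
        sets_uniform_count_measure_count_space refl] refl]
    by auto
qed

lemma output_prob_complement:
  assumes "is_protocol d n m L s P" "prob_space G" "sets G = sets (\<Pi>\<^sub>M i\<in>{..<d}. borel)"
  shows "output_prob n m s P G False = 1 - output_prob n m s P G True"
proof -
  interpret prob_space "joint_law n m s P G"
    using assms(1,2) by (rule prob_space_joint_law)
  have "(\<lambda>\<omega>. referee_test P (messages n P \<omega>)) \<in> joint_law n m s P G \<rightarrow>\<^sub>M count_space UNIV"
    by (rule measurable_compose[OF measurable_messages[OF assms(1,3)]]) simp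
  then have "{\<omega> \<in> space (joint_law n m s P G). referee_test P (messages n P \<omega>)} \<in> events"
    by measurable
  from prob_neg[OF this] show ?thesis by (simp add: output_prob_def)
qed

end

theory Submission
  imports Defs
begin

text \<open>
  Split the coordinates into G blocks by their residue modulo G, where G is of order
  \<open>max (d / 2^(c s)) \<ell>\<close>. The public bits select 160 pairs \<open>(a, b)\<close>, and each pair projects every block
  onto the quadratic character with phase \<open>2 \<pi> (a x\<^sup>2 + b x) / Q\<close>, x being the position inside the
  block. Since \<open>x + y\<close> and \<open>x\<^sup>2 + y\<^sup>2\<close> determine \<open>{x, y}\<close>, the total energy of the projected mean has
  expectation \<open>\<parallel>\<mu>\<parallel>\<^sup>2\<close> and second moment at most \<open>2 \<parallel>\<mu>\<parallel>\<^sup>4\<close> over a random pair; by Chebyshev the sum over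
  the pairs is at least half its mean for all but 1/40 of the public strings. Users send signs of
  projections of their sample. The null hypothesis makes all these bits unbiased, while under the
  alternative the squared biases add up to at least a constant times \<open>\<epsilon>\<^sup>2 G / d\<close>, and the referee
  detects this with a cross-correlation statistic, again by Chebyshev.
\<close>

section \<open>Second moments of quadratic characters\<close>

text \<open>The block count \<open>G\<close> is pulled from two sides. Testing of order
  \<open>G\<close> biases costs a factor \<open>sqrt G\<close> in users, so \<open>G\<close> should
  be small. But short public strings resolve only short blocks: the modulus \<open>Q\<close> must
  exceed twice the square of the largest position, or sums of two squares wrap around. Moreover the
  \<open>L\<close> bits of one user must come from different blocks to be independent, which forces
  \<open>L \<le> G\<close>. With \<open>Q = 4 ^ h\<close> a pair costs \<open>4 h\<close> bits, so
  160 pairs cost \<open>640 h\<close>; hence c = 1/640. The energy of one pair has a variance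
  bounded only by its squared mean, so many pairs are needed: Chebyshev leaves a fraction
  \<open>4 / k\<close>, which is 1/40 for \<open>k = 160\<close>. Balance: there are
  \<open>R = 320 G\<close> rows with two groups of \<open>N\<close> bits each, where
  \<open>N\<close> is about \<open>n L / (2 R)\<close>. The null deviation is at most
  \<open>N sqrt R\<close>, the mean under the alternative at least
  \<open>N\<^sup>2 \<epsilon>\<^sup>2 G / (16 d)\<close> for a good string. Comparing them gives
  \<open>n\<close> of order \<open>d sqrt G / (L \<epsilon>\<^sup>2)\<close>.\<close>

lemma sum_lessThan_mult:
  fixes f :: "nat \<Rightarrow> 'a::comm_monoid_add"
  shows "(\<Sum>e<P * L. f e) = (\<Sum>b<L. \<Sum>a<P. f (a + P * b))"
proof -
  have "(\<Sum>e<P * L. f e) = (\<Sum>b<L. sum f {b * P..<b * P + P})"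
    by (subst sum.nat_group) (simp add: mult.commute)
  also have "\<dots> = (\<Sum>b<L. \<Sum>a<P. f (a + P * b))"
  proof (rule sum.cong[OF refl])
    fix b
    show "sum f {b * P..<b * P + P} = (\<Sum>a<P. f (a + P * b))"
      using sum.shift_bounds_nat_ivl[of f 0 "b * P" P]
      by (simp add: atLeast0LessThan add.commute mult.commute)
  qed
  finally show ?thesis .
qed

section \<open>Orthogonality and Parseval for characters of pairs of residues\<close>

lemma sum_cis_eq_0:
  fixes m :: int
  assumes "m \<noteq> 0" "\<bar>m\<bar> < int Q"
  shows "(\<Sum>a<Q. cis (2 * pi * (real a * m) / Q)) = 0"
proof -
  define z where "z = cis (2 * pi * m / Q)"
  have Q: "Q > 0" using assms by linarith
  have "z \<noteq> 1"
  proof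
    assume "z = 1"
    then have "cos (2 * pi * m / Q) = 1" by (auto simp: z_def complex_eq_iff)
    then obtain j :: int where "2 * pi * m / Q = 2 * pi * j"
      by (metis cos_one_2pi_int mult.assoc mult.commute)
    then have "real_of_int m = real_of_int (j * int Q)"
      using Q by (simp add: field_simps)
    then have "m = j * int Q" by linarith
    then show False
      using assms by (metis dvd_triv_right zdvd_not_zless zero_less_abs_iff dvd_abs_iff)
  qed
  moreover have "z ^ Q = 1"
  proof -
    have "real Q * (2 * pi * real_of_int m / real Q) = 2 * pi * real_of_int m"
      using Q by (simp add: field_simps)
    then show ?thesis by (simp add: z_def Complex.DeMoivre)
  qed
  ultimately have "(\<Sum>a<Q. z ^ a) = 0" by (simp add: geometric_sum)
  moreover have "z ^ a = cis (2 * pi * (real a * m) / Q)" for a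
    by (simp add: z_def Complex.DeMoivre mult_ac)
  ultimately show ?thesis by simp
qed

text \<open>The additive characters of pairs of residues modulo \<open>Q\<close>, indexed by one
  number \<open>e < Q * Q\<close> whose two base-\<open>Q\<close> digits are the frequencies.
  Quadratic phases arise at the points \<open>(x\<^sup>2, x)\<close>; a general argument makes a
  product of two values a value at the sum of the points.\<close>

definition character :: "nat \<Rightarrow> nat \<Rightarrow> nat \<times> nat \<Rightarrow> complex" where
  "character Q e = (\<lambda>(x, y). cis (2 * pi * (real (e mod Q) * real x + real (e div Q) * real y) / Q))"

text \<open>Coordinates below \<open>Q\<close> keep distinct points distinct modulo
  \<open>Q\<close>, because their differences are below \<open>Q\<close> in absolute value.\<close>

lemma sum_character:
  assumes "fst p < Q" "snd p < Q" "fst q < Q" "snd q < Q"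
  shows "(\<Sum>e<Q * Q. character Q e p * cnj (character Q e q)) =
    (if p = q then of_nat (Q * Q) else 0)"
proof -
  obtain x y x' y' where pq: "p = (x, y)" "q = (x', y')" by (metis surj_pair)
  define m where "m = int x - int x'"
  define n where "n = int y - int y'"
  have *: "(\<Sum>a<Q. cis (2 * pi * (real a * j) / Q)) = (if j = 0 then of_nat Q else 0)"
    if "\<bar>j\<bar> < int Q" for j :: int
    using sum_cis_eq_0[of j Q] that by auto
  have "(\<Sum>e<Q * Q. character Q e p * cnj (character Q e q)) =
      (\<Sum>b<Q. \<Sum>a<Q. cis (2 * pi * (real a * m) / Q) * cis (2 * pi * (real b * n) / Q))"
    unfolding sum_lessThan_mult
    by (intro sum.cong refl)
       (auto simp: character_def pq cis_cnj cis_mult m_def n_def add_divide_distrib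
         diff_divide_distrib algebra_simps)
  also have "\<dots> = (\<Sum>a<Q. cis (2 * pi * (real a * m) / Q)) * (\<Sum>b<Q. cis (2 * pi * (real b * n) / Q))"
    by (subst sum.swap) (simp add: sum_product)
  also have "\<dots> = (if p = q then of_nat (Q * Q) else 0)"
    using assms by (subst (1 2) *) (auto simp: pq m_def n_def)
  finally show ?thesis .
qed

text \<open>The map \<open>g\<close> may identify indices. Colliding pairs survive on the right-hand
  side, and both moment computations come down to counting collisions.\<close>

lemma parseval_character:
  fixes c :: "'p \<Rightarrow> real"
  assumes "finite I" and lt: "\<And>p. p \<in> I \<Longrightarrow> fst (g p) < Q \<and> snd (g p) < Q"
  shows "(\<Sum>e<Q * Q. (cmod (\<Sum>p\<in>I. of_real (c p) * character Q e (g p)))\<^sup>2) =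
    real (Q * Q) * (\<Sum>p\<in>I. \<Sum>q\<in>I. if g p = g q then c p * c q else 0)"
proof -
  have "complex_of_real (\<Sum>e<Q * Q. (cmod (\<Sum>p\<in>I. of_real (c p) * character Q e (g p)))\<^sup>2) =
      (\<Sum>e<Q * Q. \<Sum>p\<in>I. \<Sum>q\<in>I. of_real (c p * c q) * (character Q e (g p) * cnj (character Q e (g q))))"
    unfolding of_real_sum
    by (intro sum.cong refl)
       (simp add: complex_norm_square cnj_sum sum_product mult_ac del: of_real_power)
  also have "\<dots> = (\<Sum>p\<in>I. \<Sum>q\<in>I. of_real (c p * c q) *
      (\<Sum>e<Q * Q. character Q e (g p) * cnj (character Q e (g q))))"
    unfolding sum_distrib_left by (subst sum.swap, intro sum.cong refl, subst sum.swap) simp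
  also have "\<dots> = (\<Sum>p\<in>I. \<Sum>q\<in>I. of_real (c p * c q) * (if g p = g q then of_nat (Q * Q) else 0))"
    by (intro sum.cong refl arg_cong2[where f="(*)"] sum_character) (use lt in auto)
  also have "\<dots> = of_real (real (Q * Q) * (\<Sum>p\<in>I. \<Sum>q\<in>I. if g p = g q then c p * c q else 0))"
    unfolding sum_distrib_left of_real_sum
    by (intro sum.cong refl) auto
  finally show ?thesis by (simp only: of_real_eq_iff)
qed

lemma parseval_character_inj:
  fixes c :: "'p \<Rightarrow> real"
  assumes "finite I" and lt: "\<And>p. p \<in> I \<Longrightarrow> fst (g p) < Q \<and> snd (g p) < Q" and inj: "inj_on g I"
  shows "(\<Sum>e<Q * Q. (cmod (\<Sum>p\<in>I. of_real (c p) * character Q e (g p)))\<^sup>2) =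
    real (Q * Q) * (\<Sum>p\<in>I. (c p)\<^sup>2)"
proof -
  have "(\<Sum>p\<in>I. \<Sum>q\<in>I. if g p = g q then c p * c q else 0) =
      (\<Sum>p\<in>I. \<Sum>q\<in>I. if q = p then c p * c p else 0)"
    using inj by (intro sum.cong refl) (auto simp: inj_on_def)
  also have "\<dots> = (\<Sum>p\<in>I. (c p)\<^sup>2)"
    using \<open>finite I\<close> by (simp add: power2_eq_square)
  finally show ?thesis by (simp add: parseval_character[OF assms(1) lt])
qed

text \<open>Each colliding product is at most half the sum of the two squares, so each square is
  charged once per member of its fibre.\<close>

lemma parseval_character_le:
  fixes c :: "'p \<Rightarrow> real"
  assumes fin: "finite I" and lt: "\<And>p. p \<in> I \<Longrightarrow> fst (g p) < Q \<and> snd (g p) < Q"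
    and fib: "\<And>p. p \<in> I \<Longrightarrow> card {q \<in> I. g q = g p} \<le> m"
  shows "(\<Sum>e<Q * Q. (cmod (\<Sum>p\<in>I. of_real (c p) * character Q e (g p)))\<^sup>2) \<le>
    real (Q * Q) * (real m * (\<Sum>p\<in>I. (c p)\<^sup>2))"
proof -
  let ?k = "\<lambda>p. real (card {q \<in> I. g q = g p})"
  have s: "(\<Sum>q\<in>I. if g q = g p then x else 0) = ?k p * x" for p and x :: real
    using fin by (simp flip: sum.inter_filter)
  have "(\<Sum>p\<in>I. \<Sum>q\<in>I. if g p = g q then c p * c q else 0) \<le>
      (\<Sum>p\<in>I. \<Sum>q\<in>I. (if g q = g p then (c p)\<^sup>2 / 2 else 0) + (if g p = g q then (c q)\<^sup>2 / 2 else 0))"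
  proof (intro sum_mono)
    fix p q
    have "0 \<le> (c p - c q)\<^sup>2" by simp
    then show "(if g p = g q then c p * c q else 0) \<le>
       (if g q = g p then (c p)\<^sup>2 / 2 else 0) + (if g p = g q then (c q)\<^sup>2 / 2 else 0)"
      by (auto simp: power2_diff)
  qed
  also have "\<dots> = (\<Sum>p\<in>I. ?k p * (c p)\<^sup>2)"
    unfolding sum.distrib
    by (subst (2) sum.swap) (simp add: s mult.commute flip: sum.distrib)
  also have "\<dots> \<le> (\<Sum>p\<in>I. real m * (c p)\<^sup>2)"
    using fib by (intro sum_mono mult_right_mono) auto
  finally have "(\<Sum>p\<in>I. \<Sum>q\<in>I. if g p = g q then c p * c q else 0) \<le> real m * (\<Sum>p\<in>I. (c p)\<^sup>2)"
    by (simp add: sum_distrib_left)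
  then show ?thesis by (subst parseval_character[OF fin lt]) (auto intro: mult_left_mono)
qed

section \<open>Collisions of quadratic phases and the second moment\<close>

text \<open>Substituting \<open>w = x + y - z\<close> turns the second equation into
  \<open>2 (z - x) (z - y) = 0\<close>; the subtraction is the reason for passing to
  integers.\<close>

lemma sum_sum_squares_eqD:
  fixes x y z w :: nat
  assumes "x + y = z + w" "x\<^sup>2 + y\<^sup>2 = z\<^sup>2 + w\<^sup>2"
  shows "z = x \<and> w = y \<or> z = y \<and> w = x"
proof -
  have s: "int x + int y = int z + int w" "(int x)\<^sup>2 + (int y)\<^sup>2 = (int z)\<^sup>2 + (int w)\<^sup>2"
    using arg_cong[OF assms(1), of int] arg_cong[OF assms(2), of int] by simp_all
  have w: "int w = int x + int y - int z" using s by simp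
  have "(int z - int x) * (int z - int y) = 0"
    using s(2) unfolding w by (simp add: power2_eq_square algebra_simps)
  then show ?thesis using assms(1) by auto
qed

text \<open>The product of the two sums is one character sum over \<open>I \<times> J\<close> at the
  points \<open>((h i)\<^sup>2 + (h j)\<^sup>2, h i + h j)\<close>. Such a point determines the
  unordered pair of positions, so fibres have at most two elements, whence the factor 2. The same
  bound serves equal and different blocks. The condition on \<open>D\<close> rules out wrap-around
  modulo \<open>Q\<close>.\<close>

lemma second_moment_quadratic_phases:
  fixes u :: "nat \<Rightarrow> real" and I J :: "nat set" and h :: "nat \<Rightarrow> nat"
  assumes fin: "finite I" "finite J" and inj: "inj_on h I" "inj_on h J"
    and le: "\<And>i. i \<in> I \<union> J \<Longrightarrow> h i \<le> D" and D: "2 * D\<^sup>2 < Q"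
  shows "(\<Sum>e<Q * Q. (cmod (\<Sum>i\<in>I. of_real (u i) * character Q e ((h i)\<^sup>2, h i)))\<^sup>2 *
      (cmod (\<Sum>i\<in>J. of_real (u i) * character Q e ((h i)\<^sup>2, h i)))\<^sup>2)
    \<le> real (Q * Q) * (2 * ((\<Sum>i\<in>I. (u i)\<^sup>2) * (\<Sum>i\<in>J. (u i)\<^sup>2)))"
proof -
  let ?g = "\<lambda>(i, j). ((h i)\<^sup>2 + (h j)\<^sup>2, h i + h j)"
  let ?c = "\<lambda>(i, j). u i * u j"
  have D2: "2 * D < Q" using D power2_nat_le_imp_le[of D "D\<^sup>2"]
    by (cases D) (auto simp: power2_eq_square)
  have *: "(cmod (\<Sum>i\<in>I. of_real (u i) * character Q e ((h i)\<^sup>2, h i)))\<^sup>2 *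
      (cmod (\<Sum>i\<in>J. of_real (u i) * character Q e ((h i)\<^sup>2, h i)))\<^sup>2 =
      (cmod (\<Sum>p\<in>I \<times> J. of_real (?c p) * character Q e (?g p)))\<^sup>2" for e
  proof -
    have m: "character Q e ((h i)\<^sup>2, h i) * character Q e ((h j)\<^sup>2, h j) = 
        character Q e ((h i)\<^sup>2 + (h j)\<^sup>2, h i + h j)" for i j
      by (simp add: character_def cis_mult add_divide_distrib algebra_simps)
    have "(\<Sum>i\<in>I. of_real (u i) * character Q e ((h i)\<^sup>2, h i)) *
        (\<Sum>i\<in>J. of_real (u i) * character Q e ((h i)\<^sup>2, h i)) =
        (\<Sum>p\<in>I \<times> J. of_real (?c p) * character Q e (?g p))"
      unfolding sum_product sum.cartesian_product
      by (intro sum.cong refl) (auto simp flip: m)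
    from this[symmetric] show ?thesis
      by (simp only: norm_mult power_mult_distrib)
  qed
  have lt: "fst (?g p) < Q \<and> snd (?g p) < Q" if "p \<in> I \<times> J" for p
  proof -
    from that obtain i j where p: "p = (i, j)" "i \<in> I" "j \<in> J" by (elim SigmaE)
    have "h i \<le> D" "h j \<le> D" using le p by auto
    then have "(h i)\<^sup>2 \<le> D\<^sup>2" "(h j)\<^sup>2 \<le> D\<^sup>2" by (simp_all add: power_mono)
    then have "(h i)\<^sup>2 + (h j)\<^sup>2 < Q" using D by linarith
    then show ?thesis using D2 \<open>h i \<le> D\<close> \<open>h j \<le> D\<close> unfolding p by auto
  qed
  have fib: "card {q \<in> I \<times> J. ?g q = ?g p} \<le> 2" if "p \<in> I \<times> J" for p
  proof -
    from that obtain i j where p: "p = (i, j)" "i \<in> I" "j \<in> J" by (elim SigmaE)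
    let ?F = "{q \<in> I \<times> J. ?g q = ?g p}"
    have "(\<lambda>(a, b). (h a, h b)) ` ?F \<subseteq> {(h i, h j), (h j, h i)}"
    proof
      fix v assume "v \<in> (\<lambda>(a, b). (h a, h b)) ` ?F"
      then obtain a b where v: "v = (h a, h b)" "h i + h j = h a + h b" "(h i)\<^sup>2 + (h j)\<^sup>2 = (h a)\<^sup>2 + (h b)\<^sup>2"
        unfolding p by auto
      from sum_sum_squares_eqD[OF v(2,3)] show "v \<in> {(h i, h j), (h j, h i)}" unfolding v(1) by auto
    qed
    then have "card ((\<lambda>(a, b). (h a, h b)) ` ?F) \<le> card {(h i, h j), (h j, h i)}"
      by (intro card_mono) auto
    also have "card {v, w} \<le> 2" for v w :: "nat \<times> nat" by (cases "v = w") simp_all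
    finally have "card ((\<lambda>(a, b). (h a, h b)) ` ?F) \<le> 2" .
    \<comment> \<open>Injectivity of \<open>h\<close> on \<open>I\<close> and on \<open>J\<close>
      separately suffices, since the components are compared one by one.\<close>
    moreover have "inj_on (\<lambda>(a, b). (h a, h b)) ?F"
    proof (rule inj_onI)
      fix v w assume v: "v \<in> ?F" and w: "w \<in> ?F"
        and e: "(\<lambda>(a, b). (h a, h b)) v = (\<lambda>(a, b). (h a, h b)) w"
      then have "h (fst v) = h (fst w)" "h (snd v) = h (snd w)" by (simp_all add: case_prod_beta)
      moreover have "fst v \<in> I" "fst w \<in> I" "snd v \<in> J" "snd w \<in> J" using v w by auto
      ultimately show "v = w" using inj by (simp add: inj_on_eq_iff prod_eq_iff)
    qed
    ultimately show ?thesis by (simp add: card_image)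
  qed
  have "(\<Sum>p\<in>I \<times> J. (?c p)\<^sup>2) = (\<Sum>i\<in>I. (u i)\<^sup>2) * (\<Sum>i\<in>J. (u i)\<^sup>2)"
    unfolding sum_product sum.cartesian_product by (intro sum.cong) (auto simp: power_mult_distrib)
  moreover have "finite (I \<times> J)" using fin by simp
  ultimately show ?thesis
    using parseval_character_le[of "I \<times> J" ?g Q 2 ?c, OF _ lt fib] unfolding * by simp
qed

text \<open>The lowest \<open>k\<close> base-\<open>P\<close> digits of a uniform number below
  \<open>P ^ k * H\<close> are independent and uniform, so the variances of centred terms add. The
  induction peels off the lowest digit; \<open>H\<close> makes room for public bits beyond those
  spent on digits.\<close>

lemma sum_digits_square_le:
  fixes y :: "nat \<Rightarrow> real" and V :: real
  assumes zero: "(\<Sum>e<P. y e) = 0" and sq: "(\<Sum>e<P. (y e)\<^sup>2) \<le> P * V"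
  shows "(\<Sum>n<P ^ k * H. (\<Sum>j<k. y (n div P ^ j mod P))\<^sup>2) \<le> real (P ^ k * H) * (k * V)"
proof (induction k)
  case (Suc k)
  let ?T = "\<lambda>k n. \<Sum>j<k. y (n div P ^ j mod P)"
  let ?L = "P ^ k * H"
  have T: "?T (Suc k) (a + P * b) = y a + ?T k b" if "a < P" for a b
  proof -
    have "(a + P * b) div P ^ Suc j mod P = b div P ^ j mod P" for j
      using that by (simp add: div_mult2_eq)
    then show ?thesis using that
      by (simp only: sum.lessThan_Suc_shift) simp
  qed
  \<comment> \<open>Averaging over the lowest digit kills the cross term, since \<open>y\<close>
    sums to 0.\<close>
  have sq_add: "(\<Sum>a<P. (y a + t)\<^sup>2) = (\<Sum>a<P. (y a)\<^sup>2) + P * t\<^sup>2" for t :: real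
  proof -
    have "(\<Sum>a<P. (y a + t)\<^sup>2) = (\<Sum>a<P. (y a)\<^sup>2) + P * t\<^sup>2 + 2 * t * (\<Sum>a<P. y a)"
      by (simp add: power2_sum sum.distrib sum_distrib_left mult_ac)
    then show ?thesis by (simp add: zero)
  qed
  have "(\<Sum>n<P ^ Suc k * H. (?T (Suc k) n)\<^sup>2) = (\<Sum>b<?L. \<Sum>a<P. (y a + ?T k b)\<^sup>2)"
    using sum_lessThan_mult[of "\<lambda>n. (?T (Suc k) n)\<^sup>2" P ?L] T by (simp add: mult_ac)
  also have "\<dots> = (\<Sum>b<?L. (\<Sum>a<P. (y a)\<^sup>2) + P * (?T k b)\<^sup>2)"
    by (intro sum.cong refl sq_add)
  also have "\<dots> = ?L * (\<Sum>a<P. (y a)\<^sup>2) + P * (\<Sum>b<?L. (?T k b)\<^sup>2)"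
    unfolding sum.distrib sum_distrib_left[symmetric] by simp
  also have "\<dots> \<le> ?L * (P * V) + P * (?L * (k * V))"
    by (intro add_mono mult_left_mono Suc.IH sq) auto
  also have "\<dots> = real (P ^ Suc k * H) * (Suc k * V)" by (simp add: algebra_simps)
  finally show ?case .
qed simp

section \<open>Energy of the projected mean: moments, concentration, real rows\<close>

definition block_sum :: "nat \<Rightarrow> nat \<Rightarrow> nat \<Rightarrow> (nat \<Rightarrow> real) \<Rightarrow> nat \<Rightarrow> nat \<Rightarrow> complex" where
  "block_sum d Q G \<mu> e \<beta> =
    (\<Sum>i\<in>{i\<in>{..<d}. i mod G = \<beta>}. of_real (\<mu> i) * character Q e ((i div G)\<^sup>2, i div G))"

definition block_energy :: "nat \<Rightarrow> nat \<Rightarrow> nat \<Rightarrow> (nat \<Rightarrow> real) \<Rightarrow> nat \<Rightarrow> real" where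
  "block_energy d Q G \<mu> e = (\<Sum>\<beta><G. (cmod (block_sum d Q G \<mu> e \<beta>))\<^sup>2)"

text \<open>The two real rows \<open>Re + Im\<close> and \<open>Re - Im\<close> of a character take the value 1 at position 0, so neither vanishes
  (the imaginary part alone is 0 for the trivial character), and their squared inner products with
  \<open>\<mu>\<close> add up to twice the squared modulus.\<close>

definition row_coeff :: "nat \<Rightarrow> nat \<Rightarrow> nat \<Rightarrow> nat \<Rightarrow> nat \<Rightarrow> real" where
  "row_coeff Q G n \<rho> i = (if i mod G = \<rho> mod G then
    (let z = character Q (n div (Q * Q) ^ (\<rho> div G div 2) mod (Q * Q)) ((i div G)\<^sup>2, i div G)
     in if even (\<rho> div G) then Re z + Im z else Re z - Im z) else 0)"

lemma inj_on_div_fibre: "inj_on (\<lambda>i. i div G) {i \<in> {..<d}. i mod G = (\<beta>::nat)}"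
  by (rule inj_onI) (metis (mono_tags, lifting) mem_Collect_eq div_mult_mod_eq)

lemma sum_blocks:
  fixes f :: "nat \<Rightarrow> real"
  assumes "G > 0"
  shows "(\<Sum>\<beta><G. \<Sum>i\<in>{i\<in>{..<d}. i mod G = \<beta>}. f i) = (\<Sum>i<d. f i)"
  using assms by (intro sum.group) auto

context
  fixes d Q G D :: nat and \<mu> :: "nat \<Rightarrow> real"
  assumes G: "G > 0" and D: "\<And>i. i < d \<Longrightarrow> i div G \<le> D" and Q: "2 * D\<^sup>2 < Q"
begin

text \<open>Inside a block the points \<open>(x\<^sup>2, x)\<close> already differ in the second
  coordinate, so Parseval has no cross terms and the mean is exact.\<close>

lemma sum_block_energy: "(\<Sum>e<Q * Q. block_energy d Q G \<mu> e) = real (Q * Q) * (\<Sum>i<d. (\<mu> i)\<^sup>2)"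
proof -
  have lt: "(i div G)\<^sup>2 < Q \<and> i div G < Q" if "i < d" for i
  proof -
    have "(i div G)\<^sup>2 \<le> D\<^sup>2" by (intro power_mono D that) simp
    moreover have "i div G \<le> (i div G)\<^sup>2" by (simp add: power2_eq_square)
    ultimately show ?thesis using Q by linarith
  qed
  have "(\<Sum>e<Q * Q. block_energy d Q G \<mu> e) =
      (\<Sum>\<beta><G. \<Sum>e<Q * Q. (cmod (block_sum d Q G \<mu> e \<beta>))\<^sup>2)"
    unfolding block_energy_def by (rule sum.swap)
  also have "\<dots> = (\<Sum>\<beta><G. real (Q * Q) * (\<Sum>i\<in>{i\<in>{..<d}. i mod G = \<beta>}. (\<mu> i)\<^sup>2))"
    unfolding block_sum_def
  proof (intro sum.cong refl parseval_character_inj)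
    fix \<beta>
    show "inj_on (\<lambda>i. ((i div G)\<^sup>2, i div G)) {i \<in> {..<d}. i mod G = \<beta>}"
      using inj_on_div_fibre[of G d \<beta>] by (simp add: inj_on_def)
  qed (use lt in auto)
  finally show ?thesis unfolding sum_distrib_left[symmetric] sum_blocks[OF G] .
qed

text \<open>The square expands over ordered pairs of blocks, equal ones included. Each pair
  contributes at most twice the product of the squared block norms, and these products recombine
  into the fourth power of the norm.\<close>

lemma sum_block_energy_square:
  "(\<Sum>e<Q * Q. (block_energy d Q G \<mu> e)\<^sup>2) \<le> real (Q * Q) * (2 * (\<Sum>i<d. (\<mu> i)\<^sup>2)\<^sup>2)"
proof -
  let ?s = "\<lambda>\<beta>. \<Sum>i\<in>{i\<in>{..<d}. i mod G = \<beta>}. (\<mu> i)\<^sup>2"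
  have "(\<Sum>e<Q * Q. (block_energy d Q G \<mu> e)\<^sup>2) = (\<Sum>\<beta><G. \<Sum>\<gamma><G. \<Sum>e<Q * Q.
      (cmod (block_sum d Q G \<mu> e \<beta>))\<^sup>2 * (cmod (block_sum d Q G \<mu> e \<gamma>))\<^sup>2)"
    unfolding block_energy_def power2_eq_square[of "sum _ _"] sum_product
    by (subst sum.swap) (intro sum.cong refl sum.swap)
  also have "\<dots> \<le> (\<Sum>\<beta><G. \<Sum>\<gamma><G. real (Q * Q) * (2 * (?s \<beta> * ?s \<gamma>)))"
    unfolding block_sum_def using D Q
    by (intro sum_mono second_moment_quadratic_phases[where D=D] inj_on_div_fibre) auto
  also have "\<dots> = real (Q * Q) * (2 * ((\<Sum>\<beta><G. ?s \<beta>) * (\<Sum>\<gamma><G. ?s \<gamma>)))"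
    by (subst sum_product) (simp only: sum_distrib_left)
  finally show ?thesis unfolding sum_blocks[OF G] by (simp add: power2_eq_square)
qed

text \<open>Chebyshev: the sum over \<open>k\<close> digits has variance at most
  \<open>k * S\<^sup>2\<close>, with \<open>S\<close> the squared norm, while falling to half the
  mean is a deviation of \<open>k * S / 2\<close>. The quotient is \<open>4 / k\<close>.\<close>

lemma card_low_energy:
  assumes k: "k > 0" and pos: "(\<Sum>i<d. (\<mu> i)\<^sup>2) > 0"
  shows "real (card {n \<in> {..<(Q * Q) ^ k * H}.
      (\<Sum>j<k. block_energy d Q G \<mu> (n div (Q * Q) ^ j mod (Q * Q))) \<le> k * (\<Sum>i<d. (\<mu> i)\<^sup>2) / 2})
    \<le> 4 / k * real ((Q * Q) ^ k * H)"
proof -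
  define S where "S = (\<Sum>i<d. (\<mu> i)\<^sup>2)"
  define y where "y e = block_energy d Q G \<mu> e - S" for e
  let ?P = "Q * Q" and ?M = "(Q * Q) ^ k * H"
  let ?Y = "\<lambda>n. \<Sum>j<k. y (n div ?P ^ j mod ?P)"
  let ?bad = "{n \<in> {..<?M}. (\<Sum>j<k. block_energy d Q G \<mu> (n div ?P ^ j mod ?P)) \<le> k * S / 2}"
  have "(\<Sum>e<?P. y e) = 0" unfolding y_def sum_subtractf sum_block_energy by (simp add: S_def)
  \<comment> \<open>Second moment at most \<open>2 * S\<^sup>2\<close>, minus the squared mean
    \<open>S\<^sup>2\<close>.\<close>
  moreover have "(\<Sum>e<?P. (y e)\<^sup>2) \<le> ?P * S\<^sup>2"
  proof -
    have "(\<Sum>e<?P. (y e)\<^sup>2) = (\<Sum>e<?P. (block_energy d Q G \<mu> e)\<^sup>2) + ?P * S\<^sup>2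
        - 2 * S * (\<Sum>e<?P. block_energy d Q G \<mu> e)"
      by (simp add: y_def power2_diff sum.distrib sum_subtractf sum_distrib_left mult_ac)
    then show ?thesis using sum_block_energy_square sum_block_energy
      by (simp add: S_def power2_eq_square algebra_simps)
  qed
  ultimately have V: "(\<Sum>n<?M. (?Y n)\<^sup>2) \<le> real ?M * (k * S\<^sup>2)" by (rule sum_digits_square_le)
  have S: "S > 0" using pos by (simp add: S_def)
  have "real (card ?bad) * (k * S / 2)\<^sup>2 = (\<Sum>n\<in>?bad. (k * S / 2)\<^sup>2)" by simp
  also have "\<dots> \<le> (\<Sum>n\<in>?bad. (?Y n)\<^sup>2)"
  proof (intro sum_mono)
    fix n assume "n \<in> ?bad"
    then have "k * S / 2 \<le> - ?Y n" by (simp add: y_def sum_subtractf mult.commute)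
    then have "(k * S / 2)\<^sup>2 \<le> (- ?Y n)\<^sup>2" using S by (intro power_mono) auto
    then show "(k * S / 2)\<^sup>2 \<le> (?Y n)\<^sup>2" by simp
  qed
  also have "\<dots> \<le> (\<Sum>n<?M. (?Y n)\<^sup>2)" by (intro sum_mono2) auto
  also note V
  finally have "real (card ?bad) * (k * S / 2)\<^sup>2 \<le> (4 / k * real ?M) * (k * S / 2)\<^sup>2"
    using k by (simp add: power2_eq_square field_simps)
  then have "real (card ?bad) \<le> 4 / k * real ?M" using k S by (subst (asm) mult_le_cancel_right_pos) auto
  then show ?thesis by (simp add: S_def)
qed

end

lemma sum_row_coeff_square:
  assumes G: "G > 0"
  shows "(\<Sum>\<rho><2 * k * G. (\<Sum>i<d. row_coeff Q G n \<rho> i * \<mu> i)\<^sup>2) =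
    2 * (\<Sum>j<k. block_energy d Q G \<mu> (n div (Q * Q) ^ j mod (Q * Q)))"
proof -
  define U where "U j \<beta> = block_sum d Q G \<mu> (n div (Q * Q) ^ j mod (Q * Q)) \<beta>" for j \<beta>
  have row: "(\<Sum>i<d. row_coeff Q G n \<rho> i * \<mu> i) =
      (if even (\<rho> div G) then Re (U (\<rho> div G div 2) (\<rho> mod G)) + Im (U (\<rho> div G div 2) (\<rho> mod G))
       else Re (U (\<rho> div G div 2) (\<rho> mod G)) - Im (U (\<rho> div G div 2) (\<rho> mod G)))" for \<rho>
  proof -
    have "(\<Sum>i<d. row_coeff Q G n \<rho> i * \<mu> i) =
        (\<Sum>i\<in>{i\<in>{..<d}. i mod G = \<rho> mod G}. row_coeff Q G n \<rho> i * \<mu> i)"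
      by (intro sum.mono_neutral_right) (auto simp: row_coeff_def)
    also have "\<dots> = (if even (\<rho> div G) then Re (U (\<rho> div G div 2) (\<rho> mod G)) + Im (U (\<rho> div G div 2) (\<rho> mod G))
       else Re (U (\<rho> div G div 2) (\<rho> mod G)) - Im (U (\<rho> div G div 2) (\<rho> mod G)))"
      unfolding U_def block_sum_def Re_sum Im_sum
      by (auto simp: row_coeff_def Let_def algebra_simps simp flip: sum.distrib sum_subtractf intro!: sum.cong)
    finally show ?thesis .
  qed
  have sq: "(Re z + Im z)\<^sup>2 + (Re z - Im z)\<^sup>2 = 2 * (cmod z)\<^sup>2" for z
    by (simp add: cmod_power2 power2_sum power2_diff)
  have two: "(\<Sum>t<2. f t) = f 0 + f 1" for f :: "nat \<Rightarrow> real"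
    by (simp add: numeral_2_eq_2)
  \<comment> \<open>A row number is \<open>\<beta> + G * (t + 2 * j)\<close>: block
    \<open>\<beta>\<close>, choice \<open>t\<close> between sum and difference, digit
    \<open>j\<close>.\<close>
  have "(\<Sum>\<rho><2 * k * G. (\<Sum>i<d. row_coeff Q G n \<rho> i * \<mu> i)\<^sup>2) =
      (\<Sum>j<2 * k. \<Sum>\<beta><G. (\<Sum>i<d. row_coeff Q G n (\<beta> + G * j) i * \<mu> i)\<^sup>2)"
    by (subst mult.commute) (rule sum_lessThan_mult)
  also have "\<dots> = (\<Sum>j<2 * k. \<Sum>\<beta><G. (if even j then Re (U (j div 2) \<beta>) + Im (U (j div 2) \<beta>)
       else Re (U (j div 2) \<beta>) - Im (U (j div 2) \<beta>))\<^sup>2)"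
    using G unfolding row by (intro sum.cong refl) auto
  also have "\<dots> = (\<Sum>j<k. (\<Sum>\<beta><G. (Re (U j \<beta>) + Im (U j \<beta>))\<^sup>2) + (\<Sum>\<beta><G. (Re (U j \<beta>) - Im (U j \<beta>))\<^sup>2))"
    unfolding sum_lessThan_mult two by (intro sum.cong refl) simp
  also have "\<dots> = (\<Sum>j<k. \<Sum>\<beta><G. 2 * (cmod (U j \<beta>))\<^sup>2)"
    unfolding sum.distrib[symmetric] sq ..
  finally show ?thesis by (simp add: block_energy_def U_def sum_distrib_left)
qed

lemma row_coeff_nonzero: "G > 0 \<Longrightarrow> row_coeff Q G n \<rho> (\<rho> mod G) = 1"
  by (simp add: row_coeff_def character_def Let_def)

lemma row_coeff_support: "row_coeff Q G n \<rho> i \<noteq> 0 \<Longrightarrow> i mod G = \<rho> mod G"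
  by (simp add: row_coeff_def split: if_splits)

lemma row_coeff_square_le: "(row_coeff Q G n \<rho> i)\<^sup>2 \<le> 2"
proof -
  have "(Re z + Im z)\<^sup>2 \<le> 2 * (cmod z)\<^sup>2" "(Re z - Im z)\<^sup>2 \<le> 2 * (cmod z)\<^sup>2" for z
    using zero_le_power2[of "Re z - Im z"] zero_le_power2[of "Re z + Im z"]
    by (simp_all add: cmod_power2 power2_sum power2_diff)
  then have "(Re z + Im z)\<^sup>2 \<le> 2" "(Re z - Im z)\<^sup>2 \<le> 2" if "cmod z = 1" for z
    using that by (metis mult.right_neutral one_power2)+
  moreover have "cmod (character Q e p) = 1" for e p
    by (simp add: character_def case_prod_beta)
  ultimately show ?thesis by (auto simp: row_coeff_def Let_def)
qed

text \<open>This is the variance of the row's linear form under the Gaussian, the scale against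
  which its mean is measured. A block has at most \<open>d div G + 1\<close> coordinates, hence at
  most \<open>2 * d / G\<close> as \<open>G \<le> d\<close>, and each contributes at most 2.\<close>

lemma sum_row_coeff_square_le:
  assumes "G > 0" "G \<le> d"
  shows "(\<Sum>i<d. (row_coeff Q G n \<rho> i)\<^sup>2) \<le> 4 * (real d / real G)"
proof -
  let ?I = "{i\<in>{..<d}. i mod G = \<rho> mod G}"
  have "(\<Sum>i<d. (row_coeff Q G n \<rho> i)\<^sup>2) = (\<Sum>i\<in>?I. (row_coeff Q G n \<rho> i)\<^sup>2)"
    by (intro sum.mono_neutral_right) (auto simp: row_coeff_def)
  also have "\<dots> \<le> real (card ?I) * 2"
    using sum_mono[of ?I "\<lambda>i. (row_coeff Q G n \<rho> i)\<^sup>2" "\<lambda>_. 2"] row_coeff_square_le by simp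
  finally have 1: "(\<Sum>i<d. (row_coeff Q G n \<rho> i)\<^sup>2) \<le> real (card ?I) * 2" .
  have "card ?I = card ((\<lambda>i. i div G) ` ?I)" by (rule card_image[OF inj_on_div_fibre, symmetric])
  also have "\<dots> \<le> card {..d div G}" by (intro card_mono) (auto intro: div_le_mono)
  finally have "card ?I \<le> d div G + 1" by simp
  then have "real (card ?I) \<le> real d / real G + 1"
    using of_nat_div_le_of_nat[of d G, where 'a=real] by linarith
  also have "\<dots> \<le> 2 * (real d / real G)" using assms by (simp add: field_simps)
  finally show ?thesis using 1 by simp
qed

section \<open>Independence and moments of sign statistics\<close>

lemma (in prob_space) indep_vars_singleton:
  fixes X :: "'i \<Rightarrow> 'a \<Rightarrow> 'b"
  assumes "random_variable (N i) (X i)"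
  shows "indep_vars N X {i}"
proof -
  have "prob (\<Inter>j\<in>J. A j) = (\<Prod>j\<in>J. prob (A j))" if "J \<noteq> {}" "J \<subseteq> {i}" for J and A :: "'i \<Rightarrow> 'a set"
  proof -
    have "J = {i}" using that by auto
    then show ?thesis by simp
  qed
  then show ?thesis
    using assms by (auto simp: indep_vars_def2 intro!: indep_setsI)
qed

text \<open>Variable \<open>j\<close> reads only component \<open>\<kappa> j\<close>. A joint event
  splits into one event per component; the product measure multiplies these, and the hypothesis
  factors each of them. This serves coordinates of a Gaussian, one-sample tuples and users
  alike.\<close>

lemma indep_vars_PiM_fibres:
  fixes M :: "'k \<Rightarrow> 'a measure" and g :: "'j \<Rightarrow> 'a \<Rightarrow> 'b"
  assumes fin: "finite K" "finite J" and \<kappa>: "\<And>j. j \<in> J \<Longrightarrow> \<kappa> j \<in> K"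
    and prob: "\<And>k. prob_space (M k)"
    and ind: "\<And>k. k \<in> K \<Longrightarrow> prob_space.indep_vars (M k) N g {j\<in>J. \<kappa> j = k}"
  shows "prob_space.indep_vars (PiM K M) N (\<lambda>j x. g j (x (\<kappa> j))) J"
proof -
  interpret M: prob_space "M k" for k by (rule prob)
  interpret P: prob_space "PiM K M" by (rule prob_space_PiM[OF prob])
  interpret PP: product_prob_space M K ..
  have rv: "g j \<in> M (\<kappa> j) \<rightarrow>\<^sub>M N j" if "j \<in> J" for j
    using ind[OF \<kappa>[OF that]] that unfolding M.indep_vars_def by auto
  have rvP: "(\<lambda>x. g j (x (\<kappa> j))) \<in> PiM K M \<rightarrow>\<^sub>M N j" if "j \<in> J" for j
    using measurable_compose[OF measurable_component_singleton[OF \<kappa>[OF that], where M=M] rv[OF that]] .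
  have factor: "measure (PiM K M) {x \<in> space (PiM K M). \<forall>j\<in>L. g j (x (\<kappa> j)) \<in> B j} =
      (\<Prod>j\<in>L. measure (M (\<kappa> j)) {x \<in> space (M (\<kappa> j)). g j x \<in> B j})"
    if L: "L \<subseteq> J" and B: "\<And>j. j \<in> L \<Longrightarrow> B j \<in> sets (N j)" for L B
  proof -
    \<comment> \<open>All constraints on component \<open>k\<close>; if there are none, this is the
      whole space, of mass 1.\<close>
    define E where "E k = {\<omega> \<in> space (M k). \<forall>j\<in>{j\<in>L. \<kappa> j = k}. g j \<omega> \<in> B j}" for k
    have finL: "finite L" using L fin by (auto intro: finite_subset)
    have meas: "{\<omega> \<in> space (M (\<kappa> j)). g j \<omega> \<in> B j} \<in> sets (M (\<kappa> j))" if "j \<in> L" for j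
      using measurable_sets[OF rv B] that L by (auto simp: vimage_def Int_def conj_commute)
    have E: "E k \<in> sets (M k)" for k
      unfolding E_def using finL meas by (intro sets.sets_Collect_finite_All) auto
    have mE: "measure (M k) (E k) = (\<Prod>j\<in>{j\<in>L. \<kappa> j = k}. measure (M k) {x \<in> space (M k). g j x \<in> B j})"
      if k: "k \<in> K" for k
    proof (cases "{j\<in>L. \<kappa> j = k} = {}")
      case True
      then have "E k = space (M k)" unfolding E_def by blast
      then show ?thesis unfolding True by (simp add: M.prob_space)
    next
      case False
      have "E k = (\<Inter>j\<in>{j\<in>L. \<kappa> j = k}. g j -` B j \<inter> space (M k))"
        using False by (auto simp: E_def)
      also have "measure (M k) \<dots> = (\<Prod>j\<in>{j\<in>L. \<kappa> j = k}. measure (M k) (g j -` B j \<inter> space (M k)))"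
        using False finL L B by (intro M.indep_varsD[OF ind[OF k]]) auto
      also have "\<dots> = (\<Prod>j\<in>{j\<in>L. \<kappa> j = k}. measure (M k) {x \<in> space (M k). g j x \<in> B j})"
        by (intro prod.cong refl arg_cong[where f="measure (M k)"]) auto
      finally show ?thesis .
    qed
    have "{x \<in> space (PiM K M). \<forall>j\<in>L. g j (x (\<kappa> j)) \<in> B j} = prod_emb K M K (PiE K E)"
      using L \<kappa> by (auto simp: space_PiM prod_emb_def E_def PiE_iff extensional_def)
    also have "measure (PiM K M) \<dots> = (\<Prod>k\<in>K. measure (M k) (E k))"
      using fin E by (intro PP.measure_PiM_emb) auto
    also have "\<dots> = (\<Prod>k\<in>K. \<Prod>j\<in>{j\<in>L. \<kappa> j = k}. measure (M (\<kappa> j)) {x \<in> space (M (\<kappa> j)). g j x \<in> B j})"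
      using mE by (intro prod.cong refl) auto
    also have "\<dots> = (\<Prod>j\<in>L. measure (M (\<kappa> j)) {x \<in> space (M (\<kappa> j)). g j x \<in> B j})"
      using finL fin L \<kappa> by (intro prod.group) auto
    finally show ?thesis .
  qed
  have single: "measure (PiM K M) {x \<in> space (PiM K M). g j (x (\<kappa> j)) \<in> A} =
      measure (M (\<kappa> j)) {x \<in> space (M (\<kappa> j)). g j x \<in> A}" if "j \<in> J" "A \<in> sets (N j)" for j A
    using factor[of "{j}" "\<lambda>_. A"] that by simp
  show "P.indep_vars N (\<lambda>j x. g j (x (\<kappa> j))) J"
    unfolding P.indep_vars_def2
  proof (intro conjI ballI P.indep_setsI)
    fix A L assume L: "L \<noteq> {}" "L \<subseteq> J"
      and A: "\<forall>j\<in>L. A j \<in> {(\<lambda>x. g j (x (\<kappa> j))) -` B \<inter> space (PiM K M) |B. B \<in> sets (N j)}"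
    have "\<forall>j\<in>L. \<exists>B. A j = {x \<in> space (PiM K M). g j (x (\<kappa> j)) \<in> B} \<and> B \<in> sets (N j)"
    proof
      fix j assume j: "j \<in> L"
      obtain B where "A j = (\<lambda>x. g j (x (\<kappa> j))) -` B \<inter> space (PiM K M)" "B \<in> sets (N j)"
        using bspec[OF A j] by blast
      then show "\<exists>B. A j = {x \<in> space (PiM K M). g j (x (\<kappa> j)) \<in> B} \<and> B \<in> sets (N j)"
        by (intro exI[of _ B]) auto
    qed
    from bchoice[OF this] obtain B where
      B: "A j = {x \<in> space (PiM K M). g j (x (\<kappa> j)) \<in> B j}" "B j \<in> sets (N j)" if "j \<in> L" for j
      by blast
    have "(\<Inter>j\<in>L. A j) = {x \<in> space (PiM K M). \<forall>j\<in>L. g j (x (\<kappa> j)) \<in> B j}"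
      using L B(1) by auto
    then have "P.prob (\<Inter>j\<in>L. A j) = (\<Prod>j\<in>L. measure (M (\<kappa> j)) {x \<in> space (M (\<kappa> j)). g j x \<in> B j})"
      using factor[OF L(2) B(2)] by simp
    also have "\<dots> = (\<Prod>j\<in>L. P.prob (A j))"
    proof (intro prod.cong refl)
      fix j assume j: "j \<in> L"
      show "measure (M (\<kappa> j)) {x \<in> space (M (\<kappa> j)). g j x \<in> B j} = P.prob (A j)"
        unfolding B(1)[OF j] using single[of j "B j"] j L B(2) by auto
    qed
    finally show "P.prob (\<Inter>j\<in>L. A j) = (\<Prod>j\<in>L. P.prob (A j))" .
  next
    fix j assume "j \<in> J"
    then show "{(\<lambda>x. g j (x (\<kappa> j))) -` A \<inter> space (PiM K M) |A. A \<in> sets (N j)} \<subseteq> P.events"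
      using measurable_sets[OF rvP] by blast
  qed (rule rvP)
qed

section \<open>Variances of independent sums, of sign sums and of their products\<close>

lemma (in prob_space) variance_add_indep:
  fixes X Y :: "'a \<Rightarrow> real"
  assumes ind: "indep_var borel X borel Y"
    and sq: "integrable M (\<lambda>x. (X x)\<^sup>2)" "integrable M (\<lambda>x. (Y x)\<^sup>2)"
  shows "integrable M (\<lambda>x. (X x + Y x)\<^sup>2)"
    and "variance (\<lambda>x. X x + Y x) = variance X + variance Y"
proof -
  have [measurable]: "X \<in> borel_measurable M" "Y \<in> borel_measurable M"
    using indep_var_rv1[OF ind] indep_var_rv2[OF ind] by auto
  have i: "integrable M X" "integrable M Y"
    using sq by (auto intro: square_integrable_imp_integrable)
  note p = indep_var_lebesgue_integral[OF ind i] indep_var_integrable[OF ind i]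
  show s: "integrable M (\<lambda>x. (X x + Y x)\<^sup>2)"
    unfolding power2_sum using sq p(2) by (auto simp: mult.assoc)
  have "expectation (\<lambda>x. (X x + Y x)\<^sup>2) =
      expectation (\<lambda>x. (X x)\<^sup>2) + expectation (\<lambda>x. (Y x)\<^sup>2) + 2 * (expectation X * expectation Y)"
    unfolding power2_sum using sq p by (simp add: mult.assoc)
  then show "variance (\<lambda>x. X x + Y x) = variance X + variance Y"
    using variance_eq[of "\<lambda>x. X x + Y x"] variance_eq[OF i(1) sq(1)] variance_eq[OF i(2) sq(2)] i s
    by (simp add: power2_sum)
qed

lemma (in prob_space) variance_sum_indep:
  fixes X :: "'i \<Rightarrow> 'a \<Rightarrow> real"
  assumes "finite I" "indep_vars (\<lambda>_. borel) X I" "\<And>i. i \<in> I \<Longrightarrow> integrable M (\<lambda>x. (X i x)\<^sup>2)"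
  shows "integrable M (\<lambda>x. (\<Sum>i\<in>I. X i x)\<^sup>2) \<and>
    variance (\<lambda>x. \<Sum>i\<in>I. X i x) = (\<Sum>i\<in>I. variance (X i))"
  using assms
proof (induction I rule: finite_induct)
  case (insert i I)
  have IH: "integrable M (\<lambda>x. (\<Sum>i\<in>I. X i x)\<^sup>2)"
      "variance (\<lambda>x. \<Sum>i\<in>I. X i x) = (\<Sum>i\<in>I. variance (X i))"
    using insert.IH[OF indep_vars_subset[OF insert.prems(1)]] insert.prems(2) by auto
  have "indep_var borel (X i) borel (\<lambda>\<omega>. \<Sum>i\<in>I. X i \<omega>)"
    using insert by (intro indep_vars_sum) auto
  from variance_add_indep[OF this] insert IH show ?case by auto
qed (simp add: prob_space)

lemma (in prob_space) second_moment_sum_signs: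
  fixes b :: "'i \<Rightarrow> 'a \<Rightarrow> real" and \<beta> :: real
  assumes fin: "finite S" and ind: "indep_vars (\<lambda>_. borel) b S"
    and sq: "\<And>m \<omega>. m \<in> S \<Longrightarrow> (b m \<omega>)\<^sup>2 = 1" and ex: "\<And>m. m \<in> S \<Longrightarrow> expectation (b m) = \<beta>"
  shows "integrable M (\<lambda>x. (\<Sum>m\<in>S. b m x)\<^sup>2)"
    and "expectation (\<lambda>x. \<Sum>m\<in>S. b m x) = card S * \<beta>"
    and "expectation (\<lambda>x. (\<Sum>m\<in>S. b m x)\<^sup>2) = card S * (1 - \<beta>\<^sup>2) + (card S)\<^sup>2 * \<beta>\<^sup>2"
proof -
  have [measurable]: "b m \<in> borel_measurable M" if "m \<in> S" for m
    using ind that by (auto simp: indep_vars_def)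
  have i2: "integrable M (\<lambda>x. (b m x)\<^sup>2)" if "m \<in> S" for m using sq that by simp
  have i: "integrable M (b m)" if "m \<in> S" for m
    using i2 that by (auto intro: square_integrable_imp_integrable)
  have v: "variance (b m) = 1 - \<beta>\<^sup>2" if "m \<in> S" for m
    using variance_eq[OF i[OF that] i2[OF that]] that sq ex by (simp add: prob_space)
  note vs = variance_sum_indep[OF fin ind i2]
  show I: "integrable M (\<lambda>x. (\<Sum>m\<in>S. b m x)\<^sup>2)" using vs by simp
  show E: "expectation (\<lambda>x. \<Sum>m\<in>S. b m x) = card S * \<beta>"
    using i ex by simp
  have "integrable M (\<lambda>x. \<Sum>m\<in>S. b m x)" using i by auto
  from variance_eq[OF this I] show
    "expectation (\<lambda>x. (\<Sum>m\<in>S. b m x)\<^sup>2) = card S * (1 - \<beta>\<^sup>2) + (card S)\<^sup>2 * \<beta>\<^sup>2"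
    using vs v E by (simp add: power_mult_distrib)
qed

text \<open>In one row the product of two independent sums of \<open>N\<close> signs of mean
  \<open>\<beta>\<close> has variance exactly \<open>N\<^sup>2 (1 - \<beta>\<^sup>2)\<^sup>2 + 2
  N\<^sup>3 \<beta>\<^sup>2 (1 - \<beta>\<^sup>2)\<close>. The first summand is noise, present even
  without bias; the second grows with the signal and is controlled by the mean.\<close>

lemma (in prob_space) moments_sum_products_of_sign_sums:
  fixes b :: "'i \<Rightarrow> 'a \<Rightarrow> real" and SA SB :: "'r \<Rightarrow> 'i set" and \<beta> :: "'r \<Rightarrow> real"
  assumes fin: "finite L" and ind: "indep_vars (\<lambda>_. borel) b I"
    and SA: "\<And>\<rho>. \<rho> \<in> L \<Longrightarrow> SA \<rho> \<subseteq> I \<and> finite (SA \<rho>) \<and> card (SA \<rho>) = N"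
    and SB: "\<And>\<rho>. \<rho> \<in> L \<Longrightarrow> SB \<rho> \<subseteq> I \<and> finite (SB \<rho>) \<and> card (SB \<rho>) = N"
    and disj: "disjoint_family_on (\<lambda>\<rho>. SA \<rho> \<union> SB \<rho>) L" "\<And>\<rho>. \<rho> \<in> L \<Longrightarrow> SA \<rho> \<inter> SB \<rho> = {}"
    and sq: "\<And>m \<omega>. m \<in> I \<Longrightarrow> (b m \<omega>)\<^sup>2 = 1"
    and ex: "\<And>\<rho> m. \<rho> \<in> L \<Longrightarrow> m \<in> SA \<rho> \<union> SB \<rho> \<Longrightarrow> expectation (b m) = \<beta> \<rho>"
  defines "T \<equiv> (\<lambda>\<omega>. \<Sum>\<rho>\<in>L. (\<Sum>m\<in>SA \<rho>. b m \<omega>) * (\<Sum>m\<in>SB \<rho>. b m \<omega>))"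
  shows "integrable M (\<lambda>\<omega>. (T \<omega>)\<^sup>2)"
    and "expectation T = (real N)\<^sup>2 * (\<Sum>\<rho>\<in>L. (\<beta> \<rho>)\<^sup>2)"
    and "variance T \<le> real (card L) * (real N)\<^sup>2 + 2 * real N ^ 3 * (\<Sum>\<rho>\<in>L. (\<beta> \<rho>)\<^sup>2)"
proof -
  let ?A = "\<lambda>\<rho> \<omega>. \<Sum>m\<in>SA \<rho>. b m \<omega>" and ?B = "\<lambda>\<rho> \<omega>. \<Sum>m\<in>SB \<rho>. b m \<omega>"
  have rv: "b m \<in> borel_measurable M" if "m \<in> I" for m
    using ind that by (auto simp: indep_vars_def)
  have A: "integrable M (\<lambda>x. (?A \<rho> x)\<^sup>2)" "expectation (?A \<rho>) = real N * \<beta> \<rho>"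
      "expectation (\<lambda>x. (?A \<rho> x)\<^sup>2) = real N * (1 - (\<beta> \<rho>)\<^sup>2) + (real N)\<^sup>2 * (\<beta> \<rho>)\<^sup>2"
      "?A \<rho> \<in> borel_measurable M" if \<rho>: "\<rho> \<in> L" for \<rho>
  proof -
    note sm = second_moment_sum_signs[of "SA \<rho>" b "\<beta> \<rho>"]
    have *: "finite (SA \<rho>)" "indep_vars (\<lambda>_. borel) b (SA \<rho>)"
      "\<And>m \<omega>. m \<in> SA \<rho> \<Longrightarrow> (b m \<omega>)\<^sup>2 = 1" "\<And>m. m \<in> SA \<rho> \<Longrightarrow> expectation (b m) = \<beta> \<rho>"
      using SA[OF \<rho>] sq ex[OF \<rho>] indep_vars_subset[OF ind] by auto
    show "integrable M (\<lambda>x. (?A \<rho> x)\<^sup>2)" "expectation (?A \<rho>) = real N * \<beta> \<rho>"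
      "expectation (\<lambda>x. (?A \<rho> x)\<^sup>2) = real N * (1 - (\<beta> \<rho>)\<^sup>2) + (real N)\<^sup>2 * (\<beta> \<rho>)\<^sup>2"
      using sm[OF *] SA[OF \<rho>] by auto
    show "?A \<rho> \<in> borel_measurable M" using SA[OF \<rho>] rv by (intro borel_measurable_sum) auto
  qed
  have B: "integrable M (\<lambda>x. (?B \<rho> x)\<^sup>2)" "expectation (?B \<rho>) = real N * \<beta> \<rho>"
      "expectation (\<lambda>x. (?B \<rho> x)\<^sup>2) = real N * (1 - (\<beta> \<rho>)\<^sup>2) + (real N)\<^sup>2 * (\<beta> \<rho>)\<^sup>2"
      "?B \<rho> \<in> borel_measurable M" if \<rho>: "\<rho> \<in> L" for \<rho>
  proof -
    note sm = second_moment_sum_signs[of "SB \<rho>" b "\<beta> \<rho>"]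
    have *: "finite (SB \<rho>)" "indep_vars (\<lambda>_. borel) b (SB \<rho>)"
      "\<And>m \<omega>. m \<in> SB \<rho> \<Longrightarrow> (b m \<omega>)\<^sup>2 = 1" "\<And>m. m \<in> SB \<rho> \<Longrightarrow> expectation (b m) = \<beta> \<rho>"
      using SB[OF \<rho>] sq ex[OF \<rho>] indep_vars_subset[OF ind] by auto
    show "integrable M (\<lambda>x. (?B \<rho> x)\<^sup>2)" "expectation (?B \<rho>) = real N * \<beta> \<rho>"
      "expectation (\<lambda>x. (?B \<rho> x)\<^sup>2) = real N * (1 - (\<beta> \<rho>)\<^sup>2) + (real N)\<^sup>2 * (\<beta> \<rho>)\<^sup>2"
      using sm[OF *] SB[OF \<rho>] by auto
    show "?B \<rho> \<in> borel_measurable M" using SB[OF \<rho>] rv by (intro borel_measurable_sum) auto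
  qed
  have AB: "indep_var borel (?A \<rho>) borel (?B \<rho>)" if \<rho>: "\<rho> \<in> L" for \<rho>
  proof -
    have "indep_var borel ((\<lambda>f. \<Sum>m\<in>SA \<rho>. f m) \<circ> (\<lambda>\<omega>. restrict (\<lambda>m. b m \<omega>) (SA \<rho>)))
        borel ((\<lambda>f. \<Sum>m\<in>SB \<rho>. f m) \<circ> (\<lambda>\<omega>. restrict (\<lambda>m. b m \<omega>) (SB \<rho>)))"
      using SA[OF \<rho>] SB[OF \<rho>] disj(2)[OF \<rho>]
      by (intro indep_var_compose[OF indep_var_restrict[OF ind]]) auto
    then show ?thesis by (simp add: comp_def)
  qed
  have AB2: "indep_var borel (\<lambda>\<omega>. (?A \<rho> \<omega>)\<^sup>2) borel (\<lambda>\<omega>. (?B \<rho> \<omega>)\<^sup>2)" if \<rho>: "\<rho> \<in> L" for \<rho>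
    using indep_var_compose[OF AB[OF \<rho>], of "\<lambda>x. x\<^sup>2" borel "\<lambda>x. x\<^sup>2" borel] by (simp add: comp_def)
  have p1: "integrable M (\<lambda>\<omega>. ?A \<rho> \<omega> * ?B \<rho> \<omega>)"
      "expectation (\<lambda>\<omega>. ?A \<rho> \<omega> * ?B \<rho> \<omega>) = (real N)\<^sup>2 * (\<beta> \<rho>)\<^sup>2" if \<rho>: "\<rho> \<in> L" for \<rho>
  proof -
    have i: "integrable M (?A \<rho>)" "integrable M (?B \<rho>)"
      using A[OF \<rho>] B[OF \<rho>] by (auto intro: square_integrable_imp_integrable)
    show "integrable M (\<lambda>\<omega>. ?A \<rho> \<omega> * ?B \<rho> \<omega>)" by (rule indep_var_integrable[OF AB[OF \<rho>] i])
    show "expectation (\<lambda>\<omega>. ?A \<rho> \<omega> * ?B \<rho> \<omega>) = (real N)\<^sup>2 * (\<beta> \<rho>)\<^sup>2"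
      using indep_var_lebesgue_integral[OF AB[OF \<rho>] i] A[OF \<rho>] B[OF \<rho>] by (simp add: power2_eq_square)
  qed
  have p2: "integrable M (\<lambda>\<omega>. (?A \<rho> \<omega> * ?B \<rho> \<omega>)\<^sup>2)"
      "variance (\<lambda>\<omega>. ?A \<rho> \<omega> * ?B \<rho> \<omega>) \<le> (real N)\<^sup>2 + 2 * real N ^ 3 * (\<beta> \<rho>)\<^sup>2" if \<rho>: "\<rho> \<in> L" for \<rho>
  proof -
    let ?s = "(\<beta> \<rho>)\<^sup>2"
    show i: "integrable M (\<lambda>\<omega>. (?A \<rho> \<omega> * ?B \<rho> \<omega>)\<^sup>2)"
      unfolding power_mult_distrib using A[OF \<rho>] B[OF \<rho>] by (intro indep_var_integrable[OF AB2[OF \<rho>]])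
    have e: "expectation (\<lambda>\<omega>. (?A \<rho> \<omega> * ?B \<rho> \<omega>)\<^sup>2) = (real N * (1 - ?s) + (real N)\<^sup>2 * ?s)\<^sup>2"
      unfolding power_mult_distrib using A[OF \<rho>] B[OF \<rho>]
      by (subst indep_var_lebesgue_integral[OF AB2[OF \<rho>]]) (auto simp: power2_eq_square)
    show "variance (\<lambda>\<omega>. ?A \<rho> \<omega> * ?B \<rho> \<omega>) \<le> (real N)\<^sup>2 + 2 * real N ^ 3 * (\<beta> \<rho>)\<^sup>2"
    \<comment> \<open>Only the signs of the row constrain \<open>\<beta> \<rho>\<close>. Without
      signs the product is 0; with one, nonnegativity of its variance gives
      \<open>(\<beta> \<rho>)\<^sup>2 \<le> 1\<close>.\<close>
    proof (cases "SA \<rho> = {}")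
      case False
      then obtain m where m: "m \<in> SA \<rho>" by auto
      then have mI: "m \<in> I" using SA[OF \<rho>] by auto
      have im: "integrable M (\<lambda>\<omega>. (b m \<omega>)\<^sup>2)" using sq[OF mI] by simp
      have "0 \<le> variance (b m)" by (rule variance_positive)
      also have "variance (b m) = 1 - ?s"
        using variance_eq[OF square_integrable_imp_integrable[OF rv[OF mI] im] im]
          sq[OF mI] ex[OF \<rho>, of m] m by (simp add: prob_space)
      finally have s: "?s \<le> 1" by simp
      have "variance (\<lambda>\<omega>. ?A \<rho> \<omega> * ?B \<rho> \<omega>) = (real N * (1 - ?s) + (real N)\<^sup>2 * ?s)\<^sup>2 - ((real N)\<^sup>2 * ?s)\<^sup>2"
        using variance_eq[OF p1(1)[OF \<rho>] i] e p1(2)[OF \<rho>] by simp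
      also have "\<dots> = (real N)\<^sup>2 * (1 - ?s)\<^sup>2 + 2 * real N ^ 3 * ?s * (1 - ?s)"
        by (simp add: power2_eq_square power3_eq_cube algebra_simps)
      also have "\<dots> \<le> (real N)\<^sup>2 * 1 + 2 * real N ^ 3 * ?s * 1"
      proof (rule add_mono)
        have "(1 - ?s)\<^sup>2 \<le> 1" using s by (intro power_le_one) auto
        then show "(real N)\<^sup>2 * (1 - ?s)\<^sup>2 \<le> (real N)\<^sup>2 * 1" by (rule mult_left_mono) simp
        show "2 * real N ^ 3 * ?s * (1 - ?s) \<le> 2 * real N ^ 3 * ?s * 1" by (rule mult_left_mono) simp_all
      qed
      finally show ?thesis by simp
    qed (simp add: prob_space)
  qed
  \<comment> \<open>Rows use disjoint groups of the independent signs.\<close>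
  have Tind: "indep_vars (\<lambda>_. borel) (\<lambda>\<rho> \<omega>. ?A \<rho> \<omega> * ?B \<rho> \<omega>) L"
  proof -
    have "indep_vars (\<lambda>_. borel) (\<lambda>\<rho> \<omega>. (\<lambda>f. (\<Sum>m\<in>SA \<rho>. f m) * (\<Sum>m\<in>SB \<rho>. f m))
        (restrict (\<lambda>m. b m \<omega>) (SA \<rho> \<union> SB \<rho>))) L"
      using SA SB disj(1)
      by (intro indep_vars_compose2[OF indep_vars_restrict[OF ind]] borel_measurable_times
          borel_measurable_sum measurable_component_singleton) auto
    moreover have "(\<Sum>m\<in>SA \<rho>. restrict (\<lambda>m. b m \<omega>) (SA \<rho> \<union> SB \<rho>) m) *
       (\<Sum>m\<in>SB \<rho>. restrict (\<lambda>m. b m \<omega>) (SA \<rho> \<union> SB \<rho>) m) = ?A \<rho> \<omega> * ?B \<rho> \<omega>" for \<rho> \<omega>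
      by (intro arg_cong2[where f="(*)"] sum.cong) auto
    ultimately show ?thesis by simp
  qed
  note vs = variance_sum_indep[OF fin Tind p2(1)]
  show "integrable M (\<lambda>\<omega>. (T \<omega>)\<^sup>2)" using vs unfolding T_def by simp
  show "expectation T = (real N)\<^sup>2 * (\<Sum>\<rho>\<in>L. (\<beta> \<rho>)\<^sup>2)"
    unfolding T_def using p1 by (simp add: sum_distrib_left)
  have Tv: "variance T = (\<Sum>\<rho>\<in>L. variance (\<lambda>\<omega>. ?A \<rho> \<omega> * ?B \<rho> \<omega>))"
    unfolding T_def using vs by blast
  have "variance T \<le> (\<Sum>\<rho>\<in>L. (real N)\<^sup>2 + 2 * real N ^ 3 * (\<beta> \<rho>)\<^sup>2)"
    unfolding Tv by (intro sum_mono p2(2))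
  then show "variance T \<le> real (card L) * (real N)\<^sup>2 + 2 * real N ^ 3 * (\<Sum>\<rho>\<in>L. (\<beta> \<rho>)\<^sup>2)"
    by (simp add: sum.distrib sum_distrib_left)
qed

section \<open>Signs of Gaussian linear forms\<close>

text \<open>Within one standard deviation the exponential factor is at least
  \<open>exp (- (1 / 2)) \<ge> 1 / 2\<close>, and \<open>sqrt (2 * pi) \<le> 4\<close>.\<close>

lemma normal_density_ge:
  assumes "\<sigma> > 0" "\<bar>x - \<mu>\<bar> \<le> \<sigma>"
  shows "normal_density \<mu> \<sigma> x \<ge> 1 / (8 * \<sigma>)"
proof -
  have "(x - \<mu>)\<^sup>2 \<le> \<sigma>\<^sup>2" using assms by (metis abs_le_square_iff abs_of_pos)
  then have "- (1 / 2) \<le> - (x - \<mu>)\<^sup>2 / (2 * \<sigma>\<^sup>2)" using assms by (simp add: field_simps)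
  then have "exp (- (1 / 2)) \<le> exp (- (x - \<mu>)\<^sup>2 / (2 * \<sigma>\<^sup>2))" by simp
  moreover have "1 / 2 \<le> exp (- (1 / 2) :: real)" using exp_ge_add_one_self[of "- (1 / 2) :: real"] by simp
  ultimately have e: "1 / 2 \<le> exp (- (x - \<mu>)\<^sup>2 / (2 * \<sigma>\<^sup>2))" by linarith
  have "2 * pi * \<sigma>\<^sup>2 \<le> 16 * \<sigma>\<^sup>2" using pi_less_4 by (intro mult_right_mono) auto
  then have s: "sqrt (2 * pi * \<sigma>\<^sup>2) \<le> 4 * \<sigma>" using assms by (intro real_le_lsqrt) (auto simp: power_mult_distrib)
  have p: "sqrt (2 * pi * \<sigma>\<^sup>2) > 0" using assms by simp
  have "1 / (8 * \<sigma>) = 1 / (4 * \<sigma>) * (1 / 2)" by simp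
  also have "\<dots> \<le> 1 / sqrt (2 * pi * \<sigma>\<^sup>2) * exp (- (x - \<mu>)\<^sup>2 / (2 * \<sigma>\<^sup>2))"
    using s p e assms by (intro mult_mono divide_left_mono) auto
  finally show ?thesis by (simp add: normal_density_def)
qed

lemma (in prob_space) normal_prob_interval_ge:
  assumes W: "distributed M lborel W (normal_density \<mu> \<sigma>)" and "\<sigma> > 0" "0 \<le> \<delta>" "\<delta> \<le> \<sigma>"
  shows "prob {x \<in> space M. \<mu> - \<delta> < W x \<and> W x < \<mu> + \<delta>} \<ge> \<delta> / (4 * \<sigma>)"
proof -
  let ?S = "{\<mu> - \<delta> <..< \<mu> + \<delta>}"
  have "ennreal (\<delta> / (4 * \<sigma>)) = (\<integral>\<^sup>+x. ennreal (1 / (8 * \<sigma>)) * indicator ?S x \<partial>lborel)"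
    using assms by (simp add: nn_integral_cmult flip: ennreal_mult)
  also have "\<dots> \<le> (\<integral>\<^sup>+x. ennreal (normal_density \<mu> \<sigma> x) * indicator ?S x \<partial>lborel)"
    using assms by (intro nn_integral_mono)
      (auto split: split_indicator intro!: ennreal_leI normal_density_ge)
  also have "\<dots> = emeasure M (W -` ?S \<inter> space M)"
    by (subst distributed_emeasure[OF W]) auto
  also have "W -` ?S \<inter> space M = {x \<in> space M. \<mu> - \<delta> < W x \<and> W x < \<mu> + \<delta>}" by auto
  finally show ?thesis by (simp add: emeasure_eq_measure)
qed

text \<open>By symmetry about \<open>\<mu>\<close> the half-lines \<open>W \<ge> 0\<close> and
  \<open>W \<le> 2 * \<mu>\<close> have equal mass, so up to sign \<open>m\<close> is the mass
  between 0 and \<open>2 * \<mu>\<close>. That interval is centred at \<open>\<mu>\<close>, and its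
  part within one standard deviation has mass at least proportional to its length. The minimum with
  1 reflects that a bias saturates for large \<open>\<mu>\<close>.\<close>

lemma (in prob_space) normal_sign_expectation:
  assumes W: "distributed M lborel W (normal_density \<mu> \<sigma>)" and \<sigma>: "\<sigma> > 0"
  defines "m \<equiv> expectation (\<lambda>x. if 0 \<le> W x then 1 else - 1 :: real)"
  shows "\<mu> = 0 \<Longrightarrow> m = 0" and "min (\<mu>\<^sup>2 / \<sigma>\<^sup>2) 1 / 16 \<le> m\<^sup>2"
proof -
  have [measurable]: "W \<in> borel_measurable M" using distributed_measurable[OF W] by simp
  have eq: "prob {x \<in> space M. W x \<le> 2 * \<mu>} = prob {x \<in> space M. 0 \<le> W x}"
  proof -
    have W': "distributed M lborel (\<lambda>x. 2 * \<mu> + (- 1) * W x) (normal_density \<mu> \<sigma>)"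
      using normal_density_affine[OF W \<sigma>, of "- 1" "2 * \<mu>"] by simp
    have "emeasure M ((\<lambda>x. 2 * \<mu> + (- 1) * W x) -` {0..} \<inter> space M) = emeasure M (W -` {0..} \<inter> space M)"
      by (subst distributed_emeasure[OF W'], simp, subst distributed_emeasure[OF W]) auto
    moreover have "(\<lambda>x. 2 * \<mu> + (- 1) * W x) -` {0..} \<inter> space M = {x \<in> space M. W x \<le> 2 * \<mu>}" by auto
    moreover have "W -` {0..} \<inter> space M = {x \<in> space M. 0 \<le> W x}" by auto
    ultimately show ?thesis by (simp add: emeasure_eq_measure)
  qed
  \<comment> \<open>Points have mass 0, so giving the value 0 the sign +1 creates no bias when
    \<open>\<mu> = 0\<close>.\<close>
  have null: "prob {x \<in> space M. W x = c} = 0" for c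
  proof -
    have "emeasure M (W -` {c} \<inter> space M) = 0"
      by (subst distributed_emeasure[OF W]) (auto simp: nn_integral_0_iff_AE AE_lborel_singleton
        intro!: AE_mp[OF AE_lborel_singleton[of c]])
    moreover have "W -` {c} \<inter> space M = {x \<in> space M. W x = c}" by auto
    ultimately show ?thesis by (simp add: emeasure_eq_measure)
  qed
  have "m = expectation (\<lambda>x. 2 * indicator {x \<in> space M. 0 \<le> W x} x - 1)"
    unfolding m_def by (intro Bochner_Integration.integral_cong) (auto split: split_indicator)
  also have "\<dots> = 2 * prob {x \<in> space M. 0 \<le> W x} - 1"
    by (subst Bochner_Integration.integral_diff) (auto simp: prob_space emeasure_eq_measure)
  finally have m: "m = prob {x \<in> space M. 0 \<le> W x} + prob {x \<in> space M. W x \<le> 2 * \<mu>} - 1"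
    using eq by simp
  have neg: "prob {x \<in> space M. \<not> P x} = 1 - prob {x \<in> space M. P x}"
    if "{x \<in> space M. P x} \<in> events" for P using prob_neg[OF that] .
  have all: "m = (if 0 \<le> \<mu> then prob {x \<in> space M. 0 \<le> W x \<and> W x \<le> 2 * \<mu>}
      else - prob {x \<in> space M. 2 * \<mu> < W x \<and> W x < 0})"
  proof (cases "0 \<le> \<mu>")
    case True
    have "prob {x \<in> space M. 0 \<le> W x} = prob ({x \<in> space M. 0 \<le> W x \<and> W x \<le> 2 * \<mu>} \<union> {x \<in> space M. \<not> W x \<le> 2 * \<mu>})"
      using True by (intro arg_cong[where f=prob]) auto
    also have "\<dots> = prob {x \<in> space M. 0 \<le> W x \<and> W x \<le> 2 * \<mu>} + prob {x \<in> space M. \<not> W x \<le> 2 * \<mu>}"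
      by (intro finite_measure_Union) auto
    also have "prob {x \<in> space M. \<not> W x \<le> 2 * \<mu>} = 1 - prob {x \<in> space M. W x \<le> 2 * \<mu>}"
      by (intro neg) simp
    finally show ?thesis using True m by simp
  next
    case False
    have "prob {x \<in> space M. \<not> 0 \<le> W x} = prob ({x \<in> space M. 2 * \<mu> < W x \<and> W x < 0} \<union> {x \<in> space M. W x \<le> 2 * \<mu>})"
      using False by (intro arg_cong[where f=prob]) auto
    also have "\<dots> = prob {x \<in> space M. 2 * \<mu> < W x \<and> W x < 0} + prob {x \<in> space M. W x \<le> 2 * \<mu>}"
      by (intro finite_measure_Union) auto
    finally have "1 - prob {x \<in> space M. 0 \<le> W x} =
        prob {x \<in> space M. 2 * \<mu> < W x \<and> W x < 0} + prob {x \<in> space M. W x \<le> 2 * \<mu>}"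
      using neg[of "\<lambda>x. 0 \<le> W x"] by simp
    then show ?thesis using False m by simp
  qed
  show "m = 0" if "\<mu> = 0"
  proof -
    have "{x \<in> space M. 0 \<le> W x \<and> W x \<le> 2 * \<mu>} = {x \<in> space M. W x = 0}" using that by auto
    then show ?thesis using that all null[of 0] by simp
  qed
  \<comment> \<open>Cut at \<open>\<sigma>\<close>, the range in which the density bound
    holds.\<close>
  define \<delta> where "\<delta> = min \<bar>\<mu>\<bar> \<sigma>"
  have "\<delta> / (4 * \<sigma>) \<le> prob {x \<in> space M. \<mu> - \<delta> < W x \<and> W x < \<mu> + \<delta>}"
    using \<sigma> by (intro normal_prob_interval_ge[OF W]) (auto simp: \<delta>_def)
  also have "\<dots> \<le> \<bar>m\<bar>"
    unfolding all by (auto simp: \<delta>_def intro!: finite_measure_mono)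
  finally have "(\<delta> / (4 * \<sigma>))\<^sup>2 \<le> \<bar>m\<bar>\<^sup>2" using \<sigma> by (intro power_mono) (auto simp: \<delta>_def)
  moreover have "(\<delta> / (4 * \<sigma>))\<^sup>2 = min (\<mu>\<^sup>2 / \<sigma>\<^sup>2) 1 / 16"
  proof (cases "\<bar>\<mu>\<bar> \<le> \<sigma>")
    case True
    then have "\<mu>\<^sup>2 \<le> \<sigma>\<^sup>2" using \<sigma> by (metis abs_le_square_iff abs_of_pos)
    then show ?thesis using True \<sigma> by (simp add: \<delta>_def power_divide power_mult_distrib min_def)
  next
    case False
    then have "\<sigma>\<^sup>2 \<le> \<mu>\<^sup>2" using \<sigma> by (metis abs_le_square_iff abs_of_pos linear)
    then have "1 \<le> \<mu>\<^sup>2 / \<sigma>\<^sup>2" using \<sigma> by simp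
    then show ?thesis using False \<sigma> by (simp add: \<delta>_def power_divide power_mult_distrib min_def)
  qed
  ultimately show "min (\<mu>\<^sup>2 / \<sigma>\<^sup>2) 1 / 16 \<le> m\<^sup>2" by simp
qed

lemma (in prob_space) weighted_sum_normal:
  fixes X :: "'i \<Rightarrow> 'a \<Rightarrow> real"
  assumes fin: "finite I" and ind: "indep_vars (\<lambda>_. borel) X I"
    and X: "\<And>i. i \<in> I \<Longrightarrow> distributed M lborel (X i) (normal_density (\<mu> i) 1)"
    and nz: "\<exists>i\<in>I. w i \<noteq> 0"
  shows "distributed M lborel (\<lambda>x. \<Sum>i\<in>I. w i * X i x)
    (normal_density (\<Sum>i\<in>I. w i * \<mu> i) (sqrt (\<Sum>i\<in>I. (w i)\<^sup>2)))"
proof -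
  \<comment> \<open>Zero weights are dropped because a constant is not normal with positive standard
    deviation.\<close>
  define J where "J = {i\<in>I. w i \<noteq> 0}"
  have J: "finite J" "J \<subseteq> I" "J \<noteq> {}" using fin nz by (auto simp: J_def)
  have s: "(\<Sum>i\<in>I. f i) = (\<Sum>i\<in>J. f i)" if "\<And>i. w i = 0 \<Longrightarrow> f i = (0::real)" for f
    using J(1) fin by (intro sum.mono_neutral_right) (auto simp: J_def that)
  have "distributed M lborel (\<lambda>x. \<Sum>i\<in>J. w i * X i x)
    (normal_density (\<Sum>i\<in>J. w i * \<mu> i) (sqrt (\<Sum>i\<in>J. \<bar>w i\<bar>\<^sup>2)))"
  proof (rule sum_indep_normal)
    show "indep_vars (\<lambda>i. borel) (\<lambda>i x. w i * X i x) J"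
      by (rule indep_vars_compose2[OF indep_vars_subset[OF ind J(2)], where Y="\<lambda>i x. w i * x"]) simp
    fix i assume i: "i \<in> J"
    then show "0 < \<bar>w i\<bar>" by (simp add: J_def)
    show "distributed M lborel (\<lambda>x. w i * X i x) (normal_density (w i * \<mu> i) \<bar>w i\<bar>)"
      using normal_density_affine[OF X, of i "w i" 0] i by (simp add: J_def)
  qed (use J in auto)
  then show ?thesis by (simp add: s)
qed

lemma indep_vars_PiM_component:
  assumes fin: "finite I" and prob: "\<And>i. prob_space (M i)"
  shows "prob_space.indep_vars (PiM I M) M (\<lambda>i x. x i) I"
proof -
  have "prob_space.indep_vars (M i) M (\<lambda>_ x. x) {j\<in>I. j = i}" if "i \<in> I" for i
  proof -
    have "{j\<in>I. j = i} = {i}" using that by auto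
    then show ?thesis using prob_space.indep_vars_singleton[OF prob, where X="\<lambda>_ x. x" and N=M and i=i] by simp
  qed
  from indep_vars_PiM_fibres[OF fin fin, of "\<lambda>i. i" M M "\<lambda>_ x. x", OF _ prob this]
  show ?thesis by simp
qed

section \<open>Independence and means of the bits of all users\<close>

text \<open>Shaped like the sample factor of \<open>joint_law\<close> for one sample per user: a
  single sample is still a family over \<open>{..<1}\<close>, which is why samples are read at index
  0.\<close>

definition sample_law :: "nat \<Rightarrow> (nat \<Rightarrow> real) measure \<Rightarrow> (nat \<Rightarrow> nat \<Rightarrow> nat \<Rightarrow> real) measure" where
  "sample_law n \<gamma> = (\<Pi>\<^sub>M k\<in>{..<n}. \<Pi>\<^sub>M j\<in>{..<1}. \<gamma>)"

definition form_sign :: "nat \<Rightarrow> (nat \<Rightarrow> real) \<Rightarrow> (nat \<Rightarrow> real) \<Rightarrow> real" where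
  "form_sign d v x = (if 0 \<le> (\<Sum>i<d. v i * x i) then 1 else - 1)"

lemma measurable_form_sign:
  assumes "sets \<gamma> = sets (\<Pi>\<^sub>M i\<in>{..<d}. borel)"
  shows "form_sign d v \<in> borel_measurable \<gamma>"
proof -
  have "form_sign d v \<in> borel_measurable (\<Pi>\<^sub>M i\<in>{..<d}. borel)"
    unfolding form_sign_def by measurable
  then show ?thesis using measurable_cong_sets[OF assms refl] by blast
qed

lemma std_gaussian_coordinates:
  shows "prob_space.indep_vars (std_gaussian d \<mu>) (\<lambda>_. borel) (\<lambda>i x. x i) {..<d}"
    and "i < d \<Longrightarrow> distributed (std_gaussian d \<mu>) lborel (\<lambda>x. x i) (normal_density (\<mu> i) 1)"
proof -
  let ?M = "\<lambda>i. density lborel (\<lambda>t. ennreal (normal_density (\<mu> i) 1 t))"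
  have P: "prob_space (?M i)" for i by (simp add: prob_space_normal_density)
  interpret prob_space "std_gaussian d \<mu>" by (rule prob_space_std_gaussian)
  have "indep_vars ?M (\<lambda>i x. x i) {..<d}"
    unfolding std_gaussian_def by (rule indep_vars_PiM_component) (use P in auto)
  from indep_vars_compose2[OF this, of "\<lambda>i x. x" "\<lambda>_. borel"]
  show "indep_vars (\<lambda>_. borel) (\<lambda>i x. x i) {..<d}" by simp
  show "distributed (std_gaussian d \<mu>) lborel (\<lambda>x. x i) (normal_density (\<mu> i) 1)" if "i < d"
  proof -
    have "distr (std_gaussian d \<mu>) (?M i) (\<lambda>x. x i) = ?M i"
      unfolding std_gaussian_def using that by (intro distr_PiM_component P) auto
    moreover have "distr (std_gaussian d \<mu>) (?M i) (\<lambda>x. x i) = distr (std_gaussian d \<mu>) lborel (\<lambda>x. x i)"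
      by (intro distr_cong) auto
    moreover have "(\<lambda>x. x i) \<in> std_gaussian d \<mu> \<rightarrow>\<^sub>M lborel"
      using that measurable_component_singleton[of i "{..<d}" ?M] by (simp add: std_gaussian_def)
    ultimately show ?thesis by (simp add: distributed_def)
  qed
qed

lemma form_sign_expectation:
  fixes v \<mu> :: "nat \<Rightarrow> real"
  assumes "\<exists>i<d. v i \<noteq> 0"
  defines "\<beta> \<equiv> integral\<^sup>L (std_gaussian d \<mu>) (form_sign d v)"
  shows "(\<Sum>i<d. v i * \<mu> i) = 0 \<Longrightarrow> \<beta> = 0"
    and "min ((\<Sum>i<d. v i * \<mu> i)\<^sup>2 / (\<Sum>i<d. (v i)\<^sup>2)) 1 / 16 \<le> \<beta>\<^sup>2"
proof -
  interpret prob_space "std_gaussian d \<mu>" by (rule prob_space_std_gaussian)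
  have W: "distributed (std_gaussian d \<mu>) lborel (\<lambda>x. \<Sum>i<d. v i * x i)
      (normal_density (\<Sum>i<d. v i * \<mu> i) (sqrt (\<Sum>i<d. (v i)\<^sup>2)))"
    using assms(1) by (intro weighted_sum_normal std_gaussian_coordinates) auto
  obtain i where "i < d" "v i \<noteq> 0" using assms(1) by auto
  then have pos: "(\<Sum>i<d. (v i)\<^sup>2) > 0" by (intro sum_pos2[of _ i]) auto
  have \<beta>: "\<beta> = expectation (\<lambda>x. if 0 \<le> (\<Sum>i<d. v i * x i) then 1 else - 1)"
    by (simp add: \<beta>_def form_sign_def[abs_def])
  note ns = normal_sign_expectation[OF W, folded \<beta>]
  show "(\<Sum>i<d. v i * \<mu> i) = 0 \<Longrightarrow> \<beta> = 0" using ns(1) pos by simp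
  show "min ((\<Sum>i<d. v i * \<mu> i)\<^sup>2 / (\<Sum>i<d. (v i)\<^sup>2)) 1 / 16 \<le> \<beta>\<^sup>2" using ns(2) pos by simp
qed

text \<open>A user owns \<open>L\<close> consecutive numbers \<open>m\<close>. As
  \<open>L \<le> G\<close>, their residues modulo \<open>G\<close> are distinct, so their forms read
  disjoint sets of coordinates of one Gaussian sample; different users hold independent
  samples.\<close>

lemma indep_form_signs:
  fixes v :: "nat \<Rightarrow> nat \<Rightarrow> real"
  assumes supp: "\<And>m i. v m i \<noteq> 0 \<Longrightarrow> i mod G = m mod G" and L: "L \<le> G" "0 < L"
  shows "prob_space.indep_vars (sample_law n (std_gaussian d \<mu>)) (\<lambda>_. borel)
    (\<lambda>m x. form_sign d (v m) (x (m div L) 0)) {..<n * L}"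
proof -
  let ?\<gamma> = "std_gaussian d \<mu>"
  let ?U = "\<Pi>\<^sub>M j\<in>{..<1::nat}. ?\<gamma>"
  have P\<gamma>: "prob_space ?\<gamma>" by (rule prob_space_std_gaussian)
  then have PU: "prob_space ?U" by (intro prob_space_PiM)
  interpret \<gamma>: prob_space ?\<gamma> by (rule P\<gamma>)
  have \<gamma>: "\<gamma>.indep_vars (\<lambda>_. borel) (\<lambda>m. form_sign d (v m)) {m\<in>{..<n * L}. m div L = k}" for k
  proof -
    let ?F = "{m\<in>{..<n * L}. m div L = k}"
    let ?K = "\<lambda>m. {i\<in>{..<d}. i mod G = m mod G}"
    have "disjoint_family_on ?K ?F"
      unfolding disjoint_family_on_def
    proof (intro ballI impI)
      fix m m' assume m: "m \<in> ?F" "m' \<in> ?F" "m \<noteq> m'"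
      \<comment> \<open>Two numbers in one window differ by less than \<open>G\<close>, whereas
        equal residues would make \<open>G\<close> divide the difference.\<close>
      have "m mod G \<noteq> m' mod G"
      proof
        assume e: "m mod G = m' mod G"
        have "m div L = k" "m' div L = k" using m by auto
        then have "m = k * L + m mod L" "m' = k * L + m' mod L"
          using div_mult_mod_eq[of m L] div_mult_mod_eq[of m' L] by simp_all
        moreover have "m mod L < L" "m' mod L < L" using L by auto
        ultimately have "\<bar>int m - int m'\<bar> < int G" using L by linarith
        moreover have "int G dvd int m - int m'"
          using e by (metis mod_eq_dvd_iff of_nat_mod)
        ultimately show False using m(3) dvd_imp_le_int[of "int m - int m'" "int G"] by linarith
      qed
      then show "?K m \<inter> ?K m' = {}" by auto
    qed
    then have "\<gamma>.indep_vars (\<lambda>_. borel) (\<lambda>m x. if 0 \<le> (\<Sum>i\<in>?K m. v m i * restrict x (?K m) i) then 1 else - 1 :: real) ?F"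
      by (intro \<gamma>.indep_vars_compose2[OF \<gamma>.indep_vars_restrict[OF std_gaussian_coordinates(1)],
          where Y="\<lambda>m x. if 0 \<le> (\<Sum>i\<in>?K m. v m i * x i) then 1 else - 1 :: real"]) auto
    moreover have "(if 0 \<le> (\<Sum>i\<in>?K m. v m i * restrict x (?K m) i) then 1 else - 1) = form_sign d (v m) x" for m x
    proof -
      have "(\<Sum>i\<in>?K m. v m i * restrict x (?K m) i) = (\<Sum>i<d. v m i * x i)"
        using supp[of m] by (intro sum.mono_neutral_cong_left) auto
      then show ?thesis by (simp add: form_sign_def)
    qed
    ultimately show ?thesis by simp
  qed
  have "prob_space.indep_vars ?U (\<lambda>_. borel) (\<lambda>m y. form_sign d (v m) (y 0)) {m\<in>{..<n * L}. m div L = k}" for k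
    using indep_vars_PiM_fibres[of "{..<1::nat}" "{m\<in>{..<n * L}. m div L = k}" "\<lambda>_. 0" "\<lambda>_. ?\<gamma>"
        "\<lambda>_. borel" "\<lambda>m. form_sign d (v m)"] \<gamma>[of k] P\<gamma> by auto
  then show ?thesis
    unfolding sample_law_def
    using indep_vars_PiM_fibres[of "{..<n}" "{..<n * L}" "\<lambda>m. m div L" "\<lambda>_. ?U"
        "\<lambda>_. borel" "\<lambda>m y. form_sign d (v m) (y 0)"] PU by (auto simp: less_mult_imp_div_less)
qed

lemma expectation_sample_law:
  fixes f :: "(nat \<Rightarrow> real) \<Rightarrow> real"
  assumes \<gamma>: "prob_space \<gamma>" and f: "f \<in> borel_measurable \<gamma>" and k: "k < n"
  shows "integral\<^sup>L (sample_law n \<gamma>) (\<lambda>x. f (x k 0)) = integral\<^sup>L \<gamma> f"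
proof -
  let ?U = "\<Pi>\<^sub>M j\<in>{..<1::nat}. \<gamma>"
  have PU: "prob_space ?U" using \<gamma> by (intro prob_space_PiM)
  have f0: "(\<lambda>y. f (y 0)) \<in> borel_measurable ?U"
    using measurable_compose[OF measurable_component_singleton[of 0 "{..<1::nat}" "\<lambda>_. \<gamma>"] f] by simp
  have "integral\<^sup>L (sample_law n \<gamma>) (\<lambda>x. f (x k 0)) =
      integral\<^sup>L (distr (sample_law n \<gamma>) ?U (\<lambda>x. x k)) (\<lambda>y. f (y 0))"
    unfolding sample_law_def using k
    by (intro integral_distr[symmetric] f0 measurable_component_singleton) auto
  also have "distr (sample_law n \<gamma>) ?U (\<lambda>x. x k) = ?U"
    unfolding sample_law_def using k PU by (intro distr_PiM_component) auto
  also have "integral\<^sup>L ?U (\<lambda>y. f (y 0)) = integral\<^sup>L (distr ?U \<gamma> (\<lambda>y. y 0)) f"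
    by (intro integral_distr[symmetric] f measurable_component_singleton) auto
  also have "distr ?U \<gamma> (\<lambda>y. y 0) = \<gamma>"
    using \<gamma> by (intro distr_PiM_component) auto
  finally show ?thesis .
qed

text \<open>Correlating two disjoint groups of N bits per row avoids the diagonal terms of a squared sum and
  leaves only second moments to compute.\<close>

definition cross_statistic :: "nat \<Rightarrow> nat \<Rightarrow> (nat \<Rightarrow> real) \<Rightarrow> real" where
  "cross_statistic R N b = (\<Sum>\<rho><R. (\<Sum>m\<in>{m\<in>{..<N * R}. m mod R = \<rho>}. b m) *
    (\<Sum>m\<in>{m\<in>{N * R..<2 * N * R}. m mod R = \<rho>}. b m))"

lemma card_residue_class:
  assumes "\<rho> < (R::nat)"
  shows "card {m\<in>{a * R..<(a + N) * R}. m mod R = \<rho>} = N"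
proof -
  have "{m\<in>{a * R..<(a + N) * R}. m mod R = \<rho>} = (\<lambda>q. \<rho> + R * q) ` {a..<a + N}"
  proof (intro set_eqI iffI)
    fix m assume m: "m \<in> {m\<in>{a * R..<(a + N) * R}. m mod R = \<rho>}"
    have "m = \<rho> + R * (m div R)" using m by auto
    moreover have "m div R < a + N" using m by (simp add: less_mult_imp_div_less)
    moreover have "a \<le> m div R" using m assms by (simp add: less_eq_div_iff_mult_less_eq)
    ultimately show "m \<in> (\<lambda>q. \<rho> + R * q) ` {a..<a + N}" by auto
  next
    fix m assume "m \<in> (\<lambda>q. \<rho> + R * q) ` {a..<a + N}"
    then obtain q where q0: "m = \<rho> + R * q" "q \<in> {a..<a + N}" by (rule imageE)
    then have q: "m = \<rho> + R * q" "a \<le> q" "q < a + N" by simp_all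
    have "a * R \<le> q * R" using q by simp
    moreover have "(q + 1) * R \<le> (a + N) * R" using q by (intro mult_right_mono) auto
    ultimately show "m \<in> {m\<in>{a * R..<(a + N) * R}. m mod R = \<rho>}"
      using assms q(1) by (auto simp: algebra_simps intro: trans_le_add2)
  qed
  also have "card \<dots> = N" using assms by (subst card_image) (auto simp: inj_on_def)
  finally show ?thesis .
qed

lemma cross_statistic_moments:
  fixes w :: "nat \<Rightarrow> nat \<Rightarrow> real" and \<mu> :: "nat \<Rightarrow> real" and n N R L G d :: nat
  assumes supp: "\<And>\<rho> i. w \<rho> i \<noteq> 0 \<Longrightarrow> i mod G = \<rho> mod G"
    and L: "L \<le> G" "0 < L" and R: "G dvd R" "0 < R" and N: "2 * N * R \<le> n * L"
  defines "M \<equiv> sample_law n (std_gaussian d \<mu>)"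
    and "T \<equiv> (\<lambda>x. cross_statistic R N (\<lambda>m. form_sign d (w (m mod R)) (x (m div L) 0)))"
    and "F \<equiv> (\<Sum>\<rho><R. (integral\<^sup>L (std_gaussian d \<mu>) (form_sign d (w \<rho>)))\<^sup>2)"
  shows "prob_space M" and "T \<in> borel_measurable M" and "integrable M (\<lambda>x. (T x)\<^sup>2)"
    and "integral\<^sup>L M T = (real N)\<^sup>2 * F"
    and "integral\<^sup>L M (\<lambda>x. (T x - integral\<^sup>L M T)\<^sup>2) \<le> real R * (real N)\<^sup>2 + 2 * real N ^ 3 * F"
proof -
  let ?\<gamma> = "std_gaussian d \<mu>"
  let ?b = "\<lambda>m x. form_sign d (w (m mod R)) (x (m div L) 0)"
  let ?\<beta> = "\<lambda>\<rho>. integral\<^sup>L ?\<gamma> (form_sign d (w \<rho>))"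
  let ?SA = "\<lambda>\<rho>. {m\<in>{..<N * R}. m mod R = \<rho>}" and ?SB = "\<lambda>\<rho>. {m\<in>{N * R..<2 * N * R}. m mod R = \<rho>}"
  have G: "0 < G" using L by simp
  show PM: "prob_space M" unfolding M_def sample_law_def by (intro prob_space_PiM prob_space_std_gaussian)
  interpret prob_space M by (rule PM)
  have ind: "indep_vars (\<lambda>_. borel) ?b {..<n * L}"
    unfolding M_def
  proof (rule indep_form_signs[OF _ L])
    \<comment> \<open>Reducing modulo \<open>R\<close> first does not change the block, because
      \<open>G\<close> divides \<open>R\<close>.\<close>
    fix m i assume "w (m mod R) i \<noteq> 0"
    then show "i mod G = m mod G" using supp R(1) by (metis mod_mod_cancel)
  qed
  have NR: "N * R \<le> 2 * N * R" by simp
  have SA: "?SA \<rho> \<subseteq> {..<n * L} \<and> finite (?SA \<rho>) \<and> card (?SA \<rho>) = N" if "\<rho> \<in> {..<R}" for \<rho>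
    using card_residue_class[of \<rho> R 0 N] that N NR by (auto simp: lessThan_atLeast0)
  have SB: "?SB \<rho> \<subseteq> {..<n * L} \<and> finite (?SB \<rho>) \<and> card (?SB \<rho>) = N" if "\<rho> \<in> {..<R}" for \<rho>
    using card_residue_class[of \<rho> R N N] that N by (auto simp: mult_2)
  have ex: "expectation (?b m) = ?\<beta> \<rho>" if "\<rho> \<in> {..<R}" "m \<in> ?SA \<rho> \<union> ?SB \<rho>" for \<rho> m
  proof -
    have "m < n * L" using that SA SB by blast
    moreover have "m mod R = \<rho>" using that by auto
    ultimately show ?thesis unfolding M_def
      by (simp add: expectation_sample_law[OF prob_space_std_gaussian
            measurable_form_sign[OF sets_std_gaussian]] less_mult_imp_div_less)
  qed
  have sq: "(?b m x)\<^sup>2 = 1" if "m \<in> {..<n * L}" for m x by (simp add: form_sign_def)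
  have disj: "disjoint_family_on (\<lambda>\<rho>. ?SA \<rho> \<union> ?SB \<rho>) {..<R}"
    by (auto simp: disjoint_family_on_def)
  have disj': "?SA \<rho> \<inter> ?SB \<rho> = {}" if "\<rho> \<in> {..<R}" for \<rho> by auto
  have T: "T = (\<lambda>x. \<Sum>\<rho><R. (\<Sum>m\<in>?SA \<rho>. ?b m x) * (\<Sum>m\<in>?SB \<rho>. ?b m x))"
    by (simp add: T_def cross_statistic_def)
  note mom = moments_sum_products_of_sign_sums[where b="?b" and SA="?SA" and SB="?SB" and \<beta>="?\<beta>",
      OF finite_lessThan ind]
  show "integrable M (\<lambda>x. (T x)\<^sup>2)"
    unfolding T by (rule mom(1)) (fact SA SB disj disj' sq ex)+
  show "expectation T = (real N)\<^sup>2 * F"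
    unfolding T F_def by (rule mom(2)) (fact SA SB disj disj' sq ex)+
  have "variance T \<le> real (card {..<R}) * (real N)\<^sup>2 + 2 * real N ^ 3 * F"
    unfolding T F_def by (rule mom(3)) (fact SA SB disj disj' sq ex)+
  then show "variance T \<le> real R * (real N)\<^sup>2 + 2 * real N ^ 3 * F" by simp
  have "?b m \<in> borel_measurable M" if "m < n * L" for m
    using ind that by (auto simp: indep_vars_def)
  then show "T \<in> borel_measurable M"
    unfolding T using SA SB by (intro borel_measurable_sum borel_measurable_times) blast+
qed

section \<open>The protocol and its error\<close>

text \<open>All biases vanish, so the mean is 0 and only the noise term \<open>R * N\<^sup>2\<close>
  of the variance bound remains; the threshold is at least 100 null standard deviations.\<close>

lemma cross_statistic_null_tail:
  fixes w :: "nat \<Rightarrow> nat \<Rightarrow> real" and n N R L G d :: nat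
  assumes supp: "\<And>\<rho> i. w \<rho> i \<noteq> 0 \<Longrightarrow> i mod G = \<rho> mod G"
    and nz: "\<And>\<rho>. \<rho> < R \<Longrightarrow> \<exists>i<d. w \<rho> i \<noteq> 0"
    and L: "L \<le> G" "0 < L" and R: "G dvd R" "0 < R" and N: "2 * N * R \<le> n * L" "0 < N"
  defines "M \<equiv> sample_law n (std_gaussian d (\<lambda>_. 0))"
    and "T \<equiv> (\<lambda>x. cross_statistic R N (\<lambda>m. form_sign d (w (m mod R)) (x (m div L) 0)))"
  shows "measure M {x \<in> space M. 100 * real N * sqrt R \<le> T x} \<le> 1 / 10"
proof -
  note mom = cross_statistic_moments[of w G L R N n d "\<lambda>_. 0", OF supp L R N(1), folded M_def T_def]
  interpret prob_space M by (rule mom(1))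
  have F0: "(\<Sum>\<rho><R. (integral\<^sup>L (std_gaussian d (\<lambda>_. 0)) (form_sign d (w \<rho>)))\<^sup>2) = 0"
    using form_sign_expectation(1)[OF nz, where \<mu>="\<lambda>_. 0"] by (intro sum.neutral) auto
  have ET: "expectation T = 0" using mom(4) F0 by simp
  have V: "variance T \<le> real R * (real N)\<^sup>2" using mom(5) F0 by (simp add: T_def)
  let ?\<theta> = "100 * real N * sqrt R"
  have \<theta>: "?\<theta> > 0" using R N by simp
  have [measurable]: "T \<in> borel_measurable M" by (rule mom(2))
  have sq: "integrable M (\<lambda>x. (T x)\<^sup>2)" using mom(3) by (simp add: T_def)
  have "prob {x \<in> space M. ?\<theta> \<le> T x} \<le> prob {x \<in> space M. \<bar>T x - expectation T\<bar> \<ge> ?\<theta>}"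
    by (intro finite_measure_mono) (auto simp: ET)
  also have "\<dots> \<le> variance T / ?\<theta>\<^sup>2" by (rule Chebyshev_inequality[OF mom(2) sq \<theta>])
  also have "\<dots> \<le> real R * (real N)\<^sup>2 / ?\<theta>\<^sup>2" by (intro divide_right_mono V) simp
  also have "\<dots> \<le> 1 / 10" using R N by (simp add: power_mult_distrib)
  finally show ?thesis .
qed

text \<open>With \<open>z = N * F\<close> the mean is \<open>N * z\<close> and the variance at most
  \<open>N\<^sup>2 * (R + 2 * z)\<close>. The hypothesis \<open>big\<close> puts the threshold at or
  below half the mean, so Chebyshev gives \<open>4 * R / z\<^sup>2 + 8 / z\<close>, at most
  \<open>1 / 10000 + 1 / 25\<close>.\<close>

lemma cross_statistic_alt_tail:
  fixes w :: "nat \<Rightarrow> nat \<Rightarrow> real" and \<mu> :: "nat \<Rightarrow> real" and n N R L G d :: nat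
  assumes supp: "\<And>\<rho> i. w \<rho> i \<noteq> 0 \<Longrightarrow> i mod G = \<rho> mod G"
    and L: "L \<le> G" "0 < L" and R: "G dvd R" "0 < R" and N: "2 * N * R \<le> n * L" "0 < N"
  defines "M \<equiv> sample_law n (std_gaussian d \<mu>)"
    and "T \<equiv> (\<lambda>x. cross_statistic R N (\<lambda>m. form_sign d (w (m mod R)) (x (m div L) 0)))"
    and "F \<equiv> (\<Sum>\<rho><R. (integral\<^sup>L (std_gaussian d \<mu>) (form_sign d (w \<rho>)))\<^sup>2)"
  assumes big: "200 * sqrt R \<le> real N * F"
  shows "measure M {x \<in> space M. T x < 100 * real N * sqrt R} \<le> 1 / 20"
proof -
  note mom = cross_statistic_moments[of w G L R N n d \<mu>, OF supp L R N(1), folded M_def T_def F_def]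
  interpret prob_space M by (rule mom(1))
  have [measurable]: "T \<in> borel_measurable M" by (rule mom(2))
  have sq: "integrable M (\<lambda>x. (T x)\<^sup>2)" using mom(3) by (simp add: T_def)
  define z where "z = real N * F"
  have sR: "sqrt R \<ge> 1" using R by simp
  have z1: "z \<ge> 200 * sqrt R" using big by (simp add: z_def)
  have z: "z \<ge> 200 * sqrt R" "z > 0" using z1 sR by linarith+
  let ?a = "real N * z / 2"
  have a: "?a > 0" using z N by simp
  have ET: "expectation T = real N * z" using mom(4) by (simp add: z_def power2_eq_square)
  have V: "variance T \<le> (real N)\<^sup>2 * (R + 2 * z)"
    using mom(5) by (simp add: T_def z_def power2_eq_square power3_eq_cube algebra_simps)
  have \<theta>: "100 * real N * sqrt R \<le> ?a"
    using mult_left_mono[OF z(1), of "real N"] by simp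
  have "prob {x \<in> space M. T x < 100 * real N * sqrt R} \<le> prob {x \<in> space M. \<bar>T x - expectation T\<bar> \<ge> ?a}"
  proof (intro finite_measure_mono subsetI)
    fix x assume x: "x \<in> {x \<in> space M. T x < 100 * real N * sqrt R}"
    then have "T x < 100 * real N * sqrt R" by blast
    then have "T x < ?a" using \<theta> by (rule less_le_trans)
    then have "?a \<le> expectation T - T x" unfolding ET by linarith
    also have "\<dots> \<le> \<bar>T x - expectation T\<bar>" by linarith
    finally show "x \<in> {x \<in> space M. \<bar>T x - expectation T\<bar> \<ge> ?a}" using x by blast
  qed measurable
  also have "\<dots> \<le> variance T / ?a\<^sup>2" by (rule Chebyshev_inequality[OF mom(2) sq a])
  also have "\<dots> \<le> (real N)\<^sup>2 * (R + 2 * z) / ?a\<^sup>2" by (intro divide_right_mono V) simp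
  also have "\<dots> = 4 * (R + 2 * z) / z\<^sup>2" using N z by (simp add: power2_eq_square field_simps)
  also have "\<dots> \<le> 1 / 20"
  proof -
    have "(200 * sqrt R)\<^sup>2 \<le> z\<^sup>2" using z by (intro power_mono) auto
    then have "40000 * real R \<le> z\<^sup>2" by (simp add: power_mult_distrib)
    moreover have "200 * z \<le> z\<^sup>2"
    proof -
      have "200 \<le> z" using z sR by linarith
      then show ?thesis using z(2) unfolding power2_eq_square by (intro mult_right_mono) auto
    qed
    moreover have "80 * (r + 2 * t) \<le> y" if "40000 * r \<le> y" "200 * t \<le> y" "0 \<le> y" for r t y :: real
      using that by simp
    ultimately have "80 * (R + 2 * z) \<le> z\<^sup>2" by simp
    then show ?thesis using z by (simp add: field_simps)
  qed
  finally show ?thesis .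
qed

text \<open>Fubini over the public string: for fixed \<open>r\<close> the event is the whole seed
  space times an event on the samples. The bound \<open>p r\<close> may depend on \<open>r\<close>,
  so that unlucky strings can be charged separately.\<close>

lemma output_prob_le_average:
  assumes Pr: "is_protocol d n (\<lambda>_. 1) L s P" and G: "prob_space G" "sets G = sets (\<Pi>\<^sub>M i\<in>{..<d}. borel)"
    and enc: "\<And>k r u x. encoder P k r u x = E k r x"
    and p: "\<And>r. length r = s \<Longrightarrow>
      measure (sample_law n G) {x \<in> space (sample_law n G). referee_test P (\<lambda>k\<in>{..<n}. E k r (x k)) = b} \<le> p r"
  shows "output_prob n (\<lambda>_. 1) s P G b \<le> (\<Sum>r | length r = s. p r) / 2 ^ s"
proof -
  let ?U = "uniform_count_measure {r::bool list. length r = s}"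
  let ?S = "\<Pi>\<^sub>M k\<in>{..<n}. private_seed P k" and ?Q = "sample_law n G"
  let ?J = "joint_law n (\<lambda>_. 1) s P G"
  let ?A = "{\<omega> \<in> space ?J. referee_test P (messages n P \<omega>) = b}"
  let ?B = "\<lambda>r. {x \<in> space ?Q. referee_test P (\<lambda>k\<in>{..<n}. E k r (x k)) = b}"
  have J: "?J = ?U \<Otimes>\<^sub>M (?S \<Otimes>\<^sub>M ?Q)" by (simp add: joint_law_def sample_law_def)
  interpret S: prob_space ?S using Pr by (intro prob_space_PiM) (auto simp: is_protocol_def)
  interpret Q: prob_space ?Q unfolding sample_law_def by (intro prob_space_PiM G)
  interpret SQ: prob_space "?S \<Otimes>\<^sub>M ?Q" by (intro prob_space_pair S.prob_space_axioms Q.prob_space_axioms)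
  interpret J: prob_space ?J by (rule prob_space_joint_law[OF Pr G(1)])
  have "(\<lambda>\<omega>. referee_test P (messages n P \<omega>)) \<in> ?J \<rightarrow>\<^sub>M count_space UNIV"
    by (rule measurable_compose[OF measurable_messages[OF Pr G(2)]]) simp
  then have A: "?A \<in> sets ?J" by measurable
  have sec: "Pair r -` ?A = space ?S \<times> ?B r" if "length r = s" for r
    using that enc
    unfolding J space_pair_measure space_uniform_count_measure messages_def by auto
  \<comment> \<open>Fixing any seed exhibits the sample event as a section of a section, hence as
    measurable.\<close>
  obtain u0 where u0: "u0 \<in> space ?S" using S.not_empty by blast
  have B: "?B r \<in> sets ?Q" if "length r = s" for r
  proof -
    have "Pair r -` ?A \<in> sets (?S \<Otimes>\<^sub>M ?Q)" using A unfolding J by (rule sets_Pair1)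
    then have "Pair u0 -` (Pair r -` ?A) \<in> sets ?Q" by (rule sets_Pair1)
    moreover have "Pair u0 -` (Pair r -` ?A) = ?B r" unfolding sec[OF that] using u0 by auto
    ultimately show ?thesis by simp
  qed
  have "emeasure ?J ?A = (\<integral>\<^sup>+r. emeasure (?S \<Otimes>\<^sub>M ?Q) (Pair r -` ?A) \<partial>?U)"
    using A unfolding J by (rule SQ.emeasure_pair_measure_alt)
  also have "\<dots> = (\<integral>\<^sup>+r. ennreal (Q.prob (?B r)) \<partial>?U)"
  proof (rule nn_integral_cong)
    fix r assume "r \<in> space ?U"
    then have r: "length r = s" by (simp add: space_uniform_count_measure)
    show "emeasure (?S \<Otimes>\<^sub>M ?Q) (Pair r -` ?A) = ennreal (Q.prob (?B r))"
      unfolding sec[OF r] using B[OF r]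
      by (simp add: Q.emeasure_pair_measure_Times S.emeasure_space_1 Q.emeasure_eq_measure)
  qed
  also have "\<dots> = (\<Sum>r | length r = s. ennreal (1 / 2 ^ s) * ennreal (Q.prob (?B r)))"
    using finite_bit_strings[of s] card_lists_length_eq[of "UNIV :: bool set" s]
    by (simp add: uniform_count_measure_def nn_integral_point_measure_finite)
  also have "\<dots> = ennreal ((\<Sum>r | length r = s. Q.prob (?B r)) / 2 ^ s)"
    by (simp add: sum_divide_distrib flip: ennreal_mult)
  finally have e: "emeasure ?J ?A = ennreal ((\<Sum>r | length r = s. Q.prob (?B r)) / 2 ^ s)" .
  have "measure ?J ?A = (\<Sum>r | length r = s. Q.prob (?B r)) / 2 ^ s"
    unfolding measure_def e by (intro enn2real_ennreal divide_nonneg_nonneg sum_nonneg) auto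
  also have "\<dots> \<le> (\<Sum>r | length r = s. p r) / 2 ^ s"
    by (intro divide_right_mono sum_mono p) auto
  finally show ?thesis unfolding output_prob_def .
qed

section \<open>From energy to squared biases\<close>

text \<open>Truncation at 1 is subadditive; this trades the saturation of each row for a single
  saturation of the total.\<close>

lemma min_one_sum_le:
  fixes x :: "'i \<Rightarrow> real"
  assumes "finite I" "\<And>i. i \<in> I \<Longrightarrow> 0 \<le> x i"
  shows "min (\<Sum>i\<in>I. x i) 1 \<le> (\<Sum>i\<in>I. min (x i) 1)"
  using assms
proof (induction I rule: finite_induct)
  case (insert i I)
  have "0 \<le> (\<Sum>i\<in>I. min (x i) 1)" using insert.prems by (intro sum_nonneg) auto
  moreover have "0 \<le> x i" "min (\<Sum>i\<in>I. x i) 1 \<le> (\<Sum>i\<in>I. min (x i) 1)" using insert by auto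
  ultimately show ?case using insert.hyps by (auto simp: min_def split: if_splits)
qed simp

text \<open>A row's squared bias is at least 1/16 of its squared mean over its variance, cut at 1,
  and that variance is at most \<open>4 * d / G\<close>. The squared means add up to twice the
  energy and so exceed \<open>k * \<epsilon>\<^sup>2\<close>; the condition \<open>4 \<le> k\<close>
  cancels the 4.\<close>

lemma sum_bias_square_ge:
  fixes \<mu> :: "nat \<Rightarrow> real"
  assumes G: "0 < G" "G \<le> d" and \<epsilon>: "0 < \<epsilon>" "\<epsilon> \<le> 1" and k: "4 \<le> k"
    and S: "\<epsilon>\<^sup>2 \<le> (\<Sum>i<d. (\<mu> i)\<^sup>2)"
    and energy: "k * (\<Sum>i<d. (\<mu> i)\<^sup>2) / 2 < (\<Sum>j<k. block_energy d Q G \<mu> (m div (Q * Q) ^ j mod (Q * Q)))"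
  shows "\<epsilon>\<^sup>2 * real G / (16 * real d) \<le>
    (\<Sum>\<rho><2 * k * G. (integral\<^sup>L (std_gaussian d \<mu>) (form_sign d (row_coeff Q G m \<rho>)))\<^sup>2)"
proof -
  let ?a = "\<lambda>\<rho>. \<Sum>i<d. row_coeff Q G m \<rho> i * \<mu> i"
  let ?s = "\<lambda>\<rho>. \<Sum>i<d. (row_coeff Q G m \<rho> i)\<^sup>2"
  let ?\<beta> = "\<lambda>\<rho>. integral\<^sup>L (std_gaussian d \<mu>) (form_sign d (row_coeff Q G m \<rho>))"
  have d: "0 < d" using G by simp
  have nz: "\<exists>i<d. row_coeff Q G m \<rho> i \<noteq> 0" for \<rho>
    using row_coeff_nonzero[OF G(1), of Q m \<rho>] mod_less_divisor[OF G(1), of \<rho>] G(2)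
    by (intro exI[of _ "\<rho> mod G"]) auto
  have spos: "0 < ?s \<rho>" for \<rho>
  proof -
    obtain i where "i < d" "row_coeff Q G m \<rho> i \<noteq> 0" using nz by blast
    then show ?thesis by (intro sum_pos2[of _ i]) auto
  qed
  have x: "(?a \<rho>)\<^sup>2 * (G / (4 * d)) \<le> (?a \<rho>)\<^sup>2 / ?s \<rho>" for \<rho>
  proof -
    have "?s \<rho> \<le> 4 * (real d / real G)" by (rule sum_row_coeff_square_le[OF G])
    then have "1 / (4 * (real d / real G)) \<le> 1 / ?s \<rho>" using spos by (intro divide_left_mono) (auto simp: d G)
    then have "(?a \<rho>)\<^sup>2 * (1 / (4 * (real d / real G))) \<le> (?a \<rho>)\<^sup>2 * (1 / ?s \<rho>)" by (intro mult_left_mono) auto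
    then show ?thesis by simp
  qed
  have "\<epsilon>\<^sup>2 * G / d \<le> k * (\<Sum>i<d. (\<mu> i)\<^sup>2) * (G / (4 * d))"
  proof -
    have "4 * \<epsilon>\<^sup>2 \<le> k * (\<Sum>i<d. (\<mu> i)\<^sup>2)" using k S by (intro mult_mono) auto
    then have "4 * \<epsilon>\<^sup>2 * (G / (4 * d)) \<le> k * (\<Sum>i<d. (\<mu> i)\<^sup>2) * (G / (4 * d))" by (intro mult_right_mono) auto
    then show ?thesis by simp
  qed
  also have "\<dots> \<le> (\<Sum>\<rho><2 * k * G. (?a \<rho>)\<^sup>2) * (G / (4 * d))"
    unfolding sum_row_coeff_square[OF G(1)] using energy by (intro mult_right_mono) auto
  also have "\<dots> \<le> (\<Sum>\<rho><2 * k * G. (?a \<rho>)\<^sup>2 / ?s \<rho>)"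
    unfolding sum_distrib_right by (intro sum_mono x)
  finally have "\<epsilon>\<^sup>2 * G / d \<le> (\<Sum>\<rho><2 * k * G. (?a \<rho>)\<^sup>2 / ?s \<rho>)" .
  \<comment> \<open>The mean vector may be arbitrarily long, so biases can saturate. The target
    value is at most 1, so the cut at 1 costs nothing.\<close>
  moreover have "\<epsilon>\<^sup>2 * G / d \<le> 1"
  proof -
    have "\<epsilon>\<^sup>2 * G \<le> 1 * real d" using \<epsilon> G by (intro mult_mono power_le_one) auto
    then show ?thesis using d by simp
  qed
  ultimately have "\<epsilon>\<^sup>2 * G / d \<le> min (\<Sum>\<rho><2 * k * G. (?a \<rho>)\<^sup>2 / ?s \<rho>) 1" by simp
  also have "\<dots> \<le> (\<Sum>\<rho><2 * k * G. min ((?a \<rho>)\<^sup>2 / ?s \<rho>) 1)"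
    using spos by (intro min_one_sum_le) (auto intro: divide_nonneg_pos)
  also have "\<dots> \<le> (\<Sum>\<rho><2 * k * G. 16 * (?\<beta> \<rho>)\<^sup>2)"
  proof (intro sum_mono)
    fix \<rho>
    show "min ((?a \<rho>)\<^sup>2 / ?s \<rho>) 1 \<le> 16 * (?\<beta> \<rho>)\<^sup>2"
    proof -
      have "x \<le> 16 * y" if "x / 16 \<le> y" for x y :: real using that by simp
      then show ?thesis using form_sign_expectation(2)[OF nz] by blast
    qed
  qed
  finally show ?thesis by (simp flip: sum_distrib_left)
qed

text \<open>Only bit numbers below \<open>2 * N * R\<close> are read. If
  \<open>2 * N * R \<le> n * L\<close> they belong to actual users, outside of which the restricted
  message family is undefined.\<close>

lemma cross_statistic_cong:
  assumes "\<And>m. m < 2 * N * R \<Longrightarrow> b m = b' m"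
  shows "cross_statistic R N b = cross_statistic R N b'"
proof -
  have "N * R \<le> 2 * N * R" by simp
  then show ?thesis unfolding cross_statistic_def
    using assms by (intro sum.cong refl arg_cong2[where f="(*)"]) auto
qed

text \<open>The i-th bit of user k has number \<open>m = k * L + i\<close> and is the sign of row \<open>m mod R\<close>. When G
  divides R and \<open>L \<le> G\<close>, the bits of one user fall into distinct blocks, so that all bits are
  independent given the public string.\<close>

definition sign_protocol ::
    "nat \<Rightarrow> nat \<Rightarrow> nat \<Rightarrow> nat \<Rightarrow> (bool list \<Rightarrow> nat \<Rightarrow> nat \<Rightarrow> real) \<Rightarrow> real protocol" where
  "sign_protocol d L R N w = \<lparr>
    private_seed = \<lambda>_. return borel 0,
    encoder = \<lambda>k r u x. map (\<lambda>i. 0 \<le> (\<Sum>j<d. w r ((k * L + i) mod R) j * x 0 j)) [0..<L],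
    referee_test = \<lambda>y. 100 * real N * sqrt R \<le>
      cross_statistic R N (\<lambda>m. if y (m div L) ! (m mod L) then 1 else - 1)\<rparr>"

lemma is_protocol_sign_protocol: "is_protocol d n (\<lambda>_. 1) (\<lambda>_. L) s (sign_protocol d L R N w)"
  unfolding is_protocol_def
proof (intro allI impI conjI)
  fix k r
  let ?P = "sign_protocol d L R N w"
  show P: "prob_space (private_seed ?P k)" by (simp add: sign_protocol_def prob_space_return)
  let ?M = "private_seed ?P k \<Otimes>\<^sub>M samples_space d 1"
  let ?f = "\<lambda>x. map (\<lambda>i. 0 \<le> (\<Sum>j<d. w r ((k * L + i) mod R) j * x 0 j)) [0..<L]"
  have c: "(\<lambda>z. snd z 0 j) \<in> borel_measurable ?M" if "j < d" for j
  proof -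
    have x0: "(\<lambda>x. x 0) \<in> samples_space d 1 \<rightarrow>\<^sub>M (\<Pi>\<^sub>M i\<in>{..<d}. borel)"
      unfolding samples_space_def by (rule measurable_component_singleton) simp
    have yj: "(\<lambda>y. y j) \<in> (\<Pi>\<^sub>M i\<in>{..<d}. borel) \<rightarrow>\<^sub>M (borel :: real measure)"
      using that by (intro measurable_component_singleton) simp
    show ?thesis by (rule measurable_compose[OF measurable_snd measurable_compose[OF x0 yj]])
  qed
  have b: "{z \<in> space ?M. (0 \<le> (\<Sum>j<d. w r \<rho> j * snd z 0 j)) = t} \<in> sets ?M" for \<rho> t
  proof -
    have [measurable]: "(\<lambda>z. \<Sum>j<d. w r \<rho> j * snd z 0 j) \<in> borel_measurable ?M"
      using c by (intro borel_measurable_sum borel_measurable_times) auto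
    show ?thesis by measurable
  qed
  have "(\<lambda>z. ?f (snd z)) \<in> ?M \<rightarrow>\<^sub>M count_space {y. length y = L}"
  proof (rule measurable_count_space_eq2[THEN iffD2, OF finite_bit_strings], intro conjI ballI)
    fix y :: "bool list" assume y: "y \<in> {y. length y = L}"
    have "(\<lambda>z. ?f (snd z)) -` {y} \<inter> space ?M =
        {z \<in> space ?M. \<forall>i\<in>{..<L}. (0 \<le> (\<Sum>j<d. w r ((k * L + i) mod R) j * snd z 0 j)) = y ! i}"
    proof -
      have "?f x = y \<longleftrightarrow> (\<forall>i\<in>{..<L}. (0 \<le> (\<Sum>j<d. w r ((k * L + i) mod R) j * x 0 j)) = y ! i)" for x
        using y by (subst list_eq_iff_nth_eq) (simp add: Ball_def)
      then show ?thesis by blast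
    qed
    also have "\<dots> \<in> sets ?M" by (intro sets.sets_Collect_finite_All b) auto
    finally show "(\<lambda>z. ?f (snd z)) -` {y} \<inter> space ?M \<in> sets ?M" .
  qed auto
  then show "(\<lambda>(u, x). encoder ?P k r u x) \<in> ?M \<rightarrow>\<^sub>M count_space {y. length y = L}"
    by (simp add: sign_protocol_def case_prod_beta')
qed

lemma referee_sign_protocol:
  assumes N: "2 * N * R \<le> n * L" and L: "0 < L"
  shows "referee_test (sign_protocol d L R N w) (\<lambda>k\<in>{..<n}. encoder (sign_protocol d L R N w) k r u (x k)) \<longleftrightarrow>
    100 * real N * sqrt R \<le> cross_statistic R N (\<lambda>m. form_sign d (w r (m mod R)) (x (m div L) 0))"
proof -
  have "cross_statistic R N (\<lambda>m. if (\<lambda>k\<in>{..<n}. encoder (sign_protocol d L R N w) k r u (x k)) (m div L) ! (m mod L)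
      then 1 else - 1) = cross_statistic R N (\<lambda>m. form_sign d (w r (m mod R)) (x (m div L) 0))"
  proof (rule cross_statistic_cong)
    fix m assume "m < 2 * N * R"
    then have "m div L < n" using N by (simp add: less_mult_imp_div_less)
    then show "(if (\<lambda>k\<in>{..<n}. encoder (sign_protocol d L R N w) k r u (x k)) (m div L) ! (m mod L)
      then 1 else - 1) = form_sign d (w r (m mod R)) (x (m div L) 0)"
      using L by (simp add: sign_protocol_def form_sign_def)
  qed
  then show ?thesis by (simp add: sign_protocol_def)
qed

text \<open>Error budget: the null bound holds for every public string. Under the alternative a
  string of high energy errs with probability at most 1/20, and those of low energy form a fraction
  of at most \<open>4 / k \<le> 1 / 40\<close>. The equation for \<open>H\<close> says that the
  number of a public string consists of \<open>k\<close> digits in base \<open>Q * Q\<close> and a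
  remaining high part.\<close>

lemma sign_protocol_error:
  fixes d L s G D Q k H N n :: nat and num :: "bool list \<Rightarrow> nat" and \<epsilon> :: real
  assumes L: "0 < L" "L \<le> G" and G: "G \<le> d" and \<epsilon>: "0 < \<epsilon>" "\<epsilon> \<le> 1"
    and D: "\<And>i. i < d \<Longrightarrow> i div G \<le> D" and Q: "2 * D\<^sup>2 < Q" and k: "160 \<le> k"
    and H: "(Q * Q) ^ k * H = 2 ^ s" and num: "bij_betw num {r. length r = s} {..<2 ^ s}"
    and N: "0 < N" "2 * N * (2 * k * G) \<le> n * L"
    and big: "200 * sqrt (2 * k * G) \<le> real N * (\<epsilon>\<^sup>2 * real G / (16 * real d))"
  shows "protocol_error d \<epsilon> n (\<lambda>_. 1) s
    (sign_protocol d L (2 * k * G) N (\<lambda>r. row_coeff Q G (num r))) \<le> 1 / 10"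
proof -
  define R where "R = 2 * k * G"
  define w where "w r = row_coeff Q G (num r)" for r
  let ?P = "sign_protocol d L R N w"
  have G0: "0 < G" using L by simp
  have R: "G dvd R" "0 < R" using k G0 by (auto simp: R_def)
  have NR: "2 * N * R \<le> n * L" using N by (simp add: R_def)
  have supp: "w r \<rho> i \<noteq> 0 \<Longrightarrow> i mod G = \<rho> mod G" for r \<rho> i
    unfolding w_def by (rule row_coeff_support)
  have nz: "\<exists>i<d. w r \<rho> i \<noteq> 0" for r \<rho>
    using row_coeff_nonzero[OF G0, of Q "num r" \<rho>] mod_less_divisor[OF G0, of \<rho>] G unfolding w_def
    by (intro exI[of _ "\<rho> mod G"]) auto
  have Pr: "is_protocol d n (\<lambda>_. 1) (\<lambda>_. L) s ?P" by (rule is_protocol_sign_protocol)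
  have enc: "encoder ?P k r u x = encoder ?P k r 0 x" for k r u x by (simp add: sign_protocol_def)
  note avg = output_prob_le_average[OF Pr prob_space_std_gaussian sets_std_gaussian enc,
      unfolded referee_sign_protocol[OF NR L(1)]]
  have cs: "card {r::bool list. length r = s} = 2 ^ s"
    using card_lists_length_eq[of "UNIV :: bool set" s] by simp
  have null: "output_prob n (\<lambda>_. 1) s ?P (std_gaussian d (\<lambda>_. 0)) True \<le> 1 / 10"
  proof -
    have "output_prob n (\<lambda>_. 1) s ?P (std_gaussian d (\<lambda>_. 0)) True \<le> (\<Sum>r::bool list | length r = s. 1 / 10) / 2 ^ s"
    proof (rule avg)
      fix r :: "bool list"
      let ?M = "sample_law n (std_gaussian d (\<lambda>_. 0))"
      let ?T = "\<lambda>x. cross_statistic R N (\<lambda>m. form_sign d (w r (m mod R)) (x (m div L) 0))"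
      have "measure ?M {x \<in> space ?M. 100 * real N * sqrt R \<le> ?T x} \<le> 1 / 10"
        by (rule cross_statistic_null_tail[where w="w r", OF supp[of r] nz L(2,1) R NR N(1)])
      then show "measure ?M {x \<in> space ?M. (100 * real N * sqrt R \<le> ?T x) = True} \<le> 1 / 10" by simp
    qed
    then show ?thesis by (simp add: cs)
  qed
  have alt: "output_prob n (\<lambda>_. 1) s ?P (std_gaussian d \<mu>) False \<le> 1 / 10" if \<mu>: "\<epsilon> \<le> L2_set \<mu> {..<d}" for \<mu>
  proof -
    let ?S = "\<Sum>i<d. (\<mu> i)\<^sup>2"
    let ?E = "\<lambda>m. \<Sum>j<k. block_energy d Q G \<mu> (m div (Q * Q) ^ j mod (Q * Q))"
    let ?bad = "{r. length r = s \<and> ?E (num r) \<le> k * ?S / 2}"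
    have "\<epsilon>\<^sup>2 \<le> (sqrt ?S)\<^sup>2" using \<mu> \<epsilon> by (intro power_mono) (auto simp: L2_set_def)
    then have S: "\<epsilon>\<^sup>2 \<le> ?S" by (simp add: sum_nonneg)
    moreover have "0 < \<epsilon>\<^sup>2" using \<epsilon> by simp
    ultimately have S0: "0 < ?S" by linarith
    \<comment> \<open>As \<open>num\<close> is injective, there are no more low-energy strings than
      low-energy numbers.\<close>
    have "card ?bad = card (num ` ?bad)"
      using num by (intro card_image[symmetric]) (auto simp: bij_betw_def inj_on_def)
    also have "\<dots> \<le> card {m \<in> {..<(Q * Q) ^ k * H}. ?E m \<le> k * ?S / 2}"
      using num by (intro card_mono) (auto simp: H bij_betw_def)
    finally have "real (card ?bad) \<le> 4 / k * real ((Q * Q) ^ k * H)"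
      using card_low_energy[OF G0 D Q _ S0, of k H] k by linarith
    also have "\<dots> \<le> 1 / 40 * 2 ^ s"
      unfolding H using k by (intro mult_mono) (auto simp: field_simps)
    finally have bad: "real (card ?bad) \<le> 2 ^ s / 40" by simp
    \<comment> \<open>Low-energy strings get a trivial bound, through an extra 1 in the pointwise
      estimate.\<close>
    have "output_prob n (\<lambda>_. 1) s ?P (std_gaussian d \<mu>) False \<le>
        (\<Sum>r::bool list | length r = s. 1 / 20 + (if r \<in> ?bad then 1 else 0)) / 2 ^ s"
    proof (rule avg)
      fix r :: "bool list" assume r: "length r = s"
      let ?M = "sample_law n (std_gaussian d \<mu>)"
      let ?T = "\<lambda>x. cross_statistic R N (\<lambda>m. form_sign d (w r (m mod R)) (x (m div L) 0))"
      have "measure ?M {x \<in> space ?M. ?T x < 100 * real N * sqrt R} \<le> 1 / 20 + (if r \<in> ?bad then 1 else 0)"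
      proof (cases "r \<in> ?bad")
        case True
        interpret prob_space ?M unfolding sample_law_def by (intro prob_space_PiM prob_space_std_gaussian)
        have "prob {x \<in> space ?M. ?T x < 100 * real N * sqrt R} \<le> 1" by (rule prob_le_1)
        also have "1 \<le> 1 / 20 + (if r \<in> ?bad then 1 else 0 :: real)" using True by simp
        finally show ?thesis .
      next
        case False
        then have "k * ?S / 2 < ?E (num r)" using r by simp
        then have "\<epsilon>\<^sup>2 * real G / (16 * real d) \<le> (\<Sum>\<rho><R. (integral\<^sup>L (std_gaussian d \<mu>) (form_sign d (w r \<rho>)))\<^sup>2)"
          unfolding w_def R_def using k by (intro sum_bias_square_ge[OF G0 G \<epsilon> _ S]) auto
        then have "real N * (\<epsilon>\<^sup>2 * real G / (16 * real d)) \<le>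
            real N * (\<Sum>\<rho><R. (integral\<^sup>L (std_gaussian d \<mu>) (form_sign d (w r \<rho>)))\<^sup>2)"
          by (intro mult_left_mono) auto
        then have "200 * sqrt R \<le>
            real N * (\<Sum>\<rho><R. (integral\<^sup>L (std_gaussian d \<mu>) (form_sign d (w r \<rho>)))\<^sup>2)"
          using big by (simp add: R_def)
        from cross_statistic_alt_tail[where w="w r", OF supp[of r] L(2,1) R NR N(1) this] False show ?thesis by simp
      qed
      then show "measure ?M {x \<in> space ?M. (100 * real N * sqrt R \<le> ?T x) = False} \<le>
          1 / 20 + (if r \<in> ?bad then 1 else 0)" by (simp add: not_le)
    qed
    also have "(\<Sum>r::bool list | length r = s. 1 / 20 + (if r \<in> ?bad then 1 else 0 :: real)) =
        2 ^ s / 20 + card ?bad"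
      unfolding sum.distrib using finite_bit_strings[of s] cs
      by (simp add: Int_def conj_ac flip: sum.inter_filter)
    also have "(2 ^ s / 20 + real (card ?bad)) / 2 ^ s \<le> 1 / 10" using bad by (simp add: field_simps)
    finally show ?thesis by simp
  qed
  \<comment> \<open>A supremum over the empty set of reals carries no bound, so a member is
    exhibited: the constant vector \<open>\<epsilon>\<close>.\<close>
  have "alt_hyp d \<epsilon> \<noteq> {}"
  proof -
    have "\<epsilon> \<le> L2_set (\<lambda>_. \<epsilon>) {..<d}"
      using member_le_L2_set[of "{..<d}" 0 "\<lambda>_. \<epsilon>"] G G0 by simp
    then show ?thesis by (auto simp: alt_hyp_def)
  qed
  then have "(SUP G\<in>alt_hyp d \<epsilon>. output_prob n (\<lambda>_. 1) s ?P G False) \<le> 1 / 10"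
  proof (rule cSUP_least)
    fix G assume "G \<in> alt_hyp d \<epsilon>"
    then obtain \<mu> where "G = std_gaussian d \<mu>" "\<epsilon> \<le> L2_set \<mu> {..<d}" by (auto simp: alt_hyp_def)
    then show "output_prob n (\<lambda>_. 1) s ?P G False \<le> 1 / 10" using alt by blast
  qed
  then show ?thesis unfolding protocol_error_def using null by (simp add: null_hyp_def R_def w_def[abs_def])
qed

section \<open>Choice of the parameters\<close>

text \<open>Two numbers below \<open>4 ^ h\<close> cost \<open>4 * h\<close> bits, and 160 such
  pairs cost \<open>640 * h\<close>. Positions up to \<open>D\<close>, of order
  \<open>2 ^ h\<close>, are resolved by the modulus \<open>4 ^ h\<close>. Blocks of at most
  \<open>D + 1\<close> positions then call for \<open>d / (D + 1)\<close> blocks, rounded up, and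
  for at least \<open>L\<close> of them.\<close>

lemma block_parameters:
  fixes d L s :: nat
  assumes L: "1 \<le> L" "L \<le> d"
  obtains G D h where "L \<le> G" "G \<le> d" "\<forall>i<d. i div G \<le> D" "2 * D\<^sup>2 < (4::nat) ^ h" "640 * h \<le> s"
    "real G \<le> 5 * max (real d / 2 powr (1 / 640 * real s)) (real L)"
proof -
  define h where "h = s div 640"
  \<comment> \<open>For \<open>h = 0\<close> this is 0: each block is a single coordinate and
    \<open>G = d\<close>. Otherwise it is \<open>2 ^ (h - 1)\<close>.\<close>
  define D :: nat where "D = 2 ^ h div 2"
  define G where "G = max L ((d + D) div (D + 1))"
  have GL: "L \<le> G" by (simp add: G_def)
  have "d + D < (d + 1) * (D + 1)" by (simp add: algebra_simps)
  then have "(d + D) div (D + 1) < d + 1" by (rule less_mult_imp_div_less)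
  then have Gd: "G \<le> d" using L by (simp add: G_def)
  have div: "\<forall>i<d. i div G \<le> D"
  proof (intro allI impI)
    fix i assume i: "i < d"
    have "d + D < ((d + D) div (D + 1)) * (D + 1) + (D + 1)"
      by (metis add.commute dividend_less_div_times zero_less_Suc Suc_eq_plus1)
    then have "i < ((d + D) div (D + 1)) * (D + 1)" using i by linarith
    also have "\<dots> \<le> G * (D + 1)" by (intro mult_right_mono) (auto simp: G_def)
    finally have "i div G < D + 1" by (intro less_mult_imp_div_less) (simp add: mult.commute)
    then show "i div G \<le> D" by simp
  qed
  have D2: "2 * D\<^sup>2 < 4 ^ h"
  proof (cases h)
    case (Suc g)
    have "(2::nat) * (2 ^ g)\<^sup>2 = 2 * 4 ^ g" by (simp add: power2_eq_square flip: power_mult_distrib)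
    then show ?thesis using Suc by (simp add: D_def)
  qed (simp add: D_def)
  have D: "2 ^ h / 2 \<le> real D + 1"
  proof -
    have "2 ^ h \<le> 2 * D + 2" unfolding D_def by simp
    then have "real (2 ^ h) \<le> real (2 * D + 2)" by (rule of_nat_mono)
    then show ?thesis by simp
  qed
  have s: "2 powr (1 / 640 * real s) \<le> 2 * 2 ^ h"
  proof -
    have "s < 640 * (h + 1)" using dividend_less_div_times[of 640 s] by (simp add: h_def)
    then have "real s < real (640 * (h + 1))" by (rule of_nat_less_iff[THEN iffD2])
    then have "1 / 640 * real s \<le> real (h + 1)" by simp
    then have "2 powr (1 / 640 * real s) \<le> 2 powr real (h + 1)" by (intro powr_mono) auto
    also have "\<dots> = 2 * 2 ^ h" by (subst powr_realpow) auto
    finally show ?thesis .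
  qed
  have "2 powr (1 / 640 * real s) / 4 \<le> real D + 1" using s D by linarith
  then have "real d / (real D + 1) \<le> real d / (2 powr (1 / 640 * real s) / 4)"
    by (intro divide_left_mono) auto
  also have "\<dots> = 4 * (real d / 2 powr (1 / 640 * real s))" by simp
  finally have dD: "real d / (real D + 1) \<le> 4 * (real d / 2 powr (1 / 640 * real s))" .
  have "real ((d + D) div (D + 1)) \<le> real (d + D) / real (D + 1)" by (rule of_nat_div_le_of_nat)
  also have "\<dots> \<le> real d / (real D + 1) + 1" by (simp add: field_simps)
  finally have c: "real ((d + D) div (D + 1)) \<le> 4 * (real d / 2 powr (1 / 640 * real s)) + 1"
    using dD by linarith
  \<comment> \<open>Origin of the 5: rounding \<open>s / 640\<close> down costs a factor 2, passing
    from \<open>2 ^ h\<close> to \<open>D + 1\<close> another 2, and the 1 from the ceiling is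
    absorbed since \<open>L \<ge> 1\<close>.\<close>
  have "real G \<le> 5 * max (real d / 2 powr (1 / 640 * real s)) (real L)"
  proof (cases "(d + D) div (D + 1) \<le> L")
    case True
    then have "G = L" by (simp add: G_def)
    then show ?thesis by simp
  next
    case False
    then have "G = (d + D) div (D + 1)" by (simp add: G_def)
    then show ?thesis using c L by (simp add: max_def split: if_splits)
  qed
  moreover have "640 * h \<le> s" by (simp add: h_def)
  ultimately show ?thesis using that GL Gd div D2 by blast
qed

theorem theorem1:
  "\<exists>C c :: real. C > 0 \<and> c > 0 \<and>
     (\<forall>(d::nat) (L::nat) (s::nat) (\<epsilon>::real) (n::nat).
        d \<ge> 1 \<longrightarrow> 1 \<le> L \<longrightarrow> L \<le> d \<longrightarrow> 0 < \<epsilon> \<longrightarrow> \<epsilon> \<le> 1 \<longrightarrow>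
        real n \<ge> C * (real d / (real L * \<epsilon>\<^sup>2)) *
                   sqrt (max (real d / 2 powr (c * real s)) (real L)) \<longrightarrow>
        (\<exists>P :: real protocol.
           is_protocol d n (\<lambda>_. 1) (\<lambda>_. L) s P \<and>
           protocol_error d \<epsilon> n (\<lambda>_. 1) s P \<le> 1 / 10))"
proof (rule exI[of _ "2 * 10 ^ 8"], rule exI[of _ "1 / 640"], intro conjI allI impI)
  fix d L s n :: nat and \<epsilon> :: real
  let ?M = "max (real d / 2 powr (1 / 640 * real s)) (real L)"
  assume d: "1 \<le> d" and L: "1 \<le> L" "L \<le> d" and \<epsilon>: "0 < \<epsilon>" "\<epsilon> \<le> 1"
    and n: "2 * 10 ^ 8 * (real d / (real L * \<epsilon>\<^sup>2)) * sqrt ?M \<le> real n"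
  obtain G D h where G: "L \<le> G" "G \<le> d" and D: "\<forall>i<d. i div G \<le> D" "2 * D\<^sup>2 < (4::nat) ^ h"
    and h: "640 * h \<le> s" and GM: "real G \<le> 5 * ?M"
    using block_parameters[OF L, of s] by blast
  define R where "R = 2 * 160 * G"
  define N where "N = n * L div (2 * R)"
  have M1: "1 \<le> ?M" using L by simp
  then have sM: "1 \<le> sqrt ?M" by simp
  have G0: "0 < G" and R0: "0 < R" using L G by (auto simp: R_def)
  have \<epsilon>2: "0 < \<epsilon>\<^sup>2" "\<epsilon>\<^sup>2 \<le> 1" using \<epsilon> by (auto intro: power_le_one)
  have nL: "2 * 10 ^ 8 * real d * sqrt ?M \<le> real n * real L * \<epsilon>\<^sup>2"
    using n L \<epsilon>2 by (simp add: field_simps)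
  \<comment> \<open>With at least \<open>4 * R\<close> bits available, rounding \<open>N\<close>
    down to an integer at most halves it and leaves it positive.\<close>
  have nR: "4 * real R \<le> real n * real L"
  proof -
    have "4 * real R \<le> 2 * 10 ^ 8 * real d * 1" using G by (simp add: R_def)
    also have "\<dots> \<le> 2 * 10 ^ 8 * real d * sqrt ?M" using sM by (intro mult_left_mono) auto
    also have "\<dots> \<le> real n * real L * \<epsilon>\<^sup>2" by (rule nL)
    also have "\<dots> \<le> real n * real L * 1" using \<epsilon>2 by (intro mult_left_mono) auto
    finally show ?thesis by simp
  qed
  have N: "real n * real L / (4 * R) \<le> real N"
  proof -
    have "n * L < N * (2 * R) + 2 * R"
      unfolding N_def using R0 dividend_less_div_times[of "2 * R" "n * L"] by (simp add: add.commute)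
    then have "real (n * L) < real (N * (2 * R) + 2 * R)" by (rule of_nat_less_iff[THEN iffD2])
    then have "real n * real L \<le> real N * (4 * R)" using nR by simp
    then show ?thesis using R0 by (simp add: divide_le_eq)
  qed
  have N0: "0 < N"
  proof -
    have "0 < real n * real L / (4 * R)" using nR R0 by (intro divide_pos_pos) auto
    then show ?thesis using N by (metis of_nat_0_less_iff less_le_trans)
  qed
  have NR: "2 * N * R \<le> n * L" unfolding N_def
    by (metis div_times_less_eq_dividend mult.assoc mult.commute)
  \<comment> \<open>Origin of the constant \<open>2 * 10 ^ 8\<close>:
    \<open>R = 320 * G \<le> 1600 * ?M\<close> makes the left side at most
    \<open>8000 * sqrt ?M\<close>, and \<open>N \<ge> n * L / (1280 * G)\<close> makes the right
    side at least \<open>n * L * \<epsilon>\<^sup>2 / (20480 * d)\<close>. The product of 8000 and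
    20480 is below \<open>2 * 10 ^ 8\<close>.\<close>
  have big: "200 * sqrt R \<le> real N * (\<epsilon>\<^sup>2 * real G / (16 * real d))"
  proof -
    have "sqrt R \<le> sqrt (40\<^sup>2 * ?M)" using GM by (intro real_sqrt_le_mono) (simp add: R_def)
    also have "\<dots> = 40 * sqrt ?M" by (simp add: real_sqrt_mult)
    finally have "200 * sqrt R \<le> 8000 * sqrt ?M" by simp
    also have "\<dots> \<le> 2 * 10 ^ 8 * real d * sqrt ?M / (20480 * d)"
      using d sM by (simp add: field_simps)
    also have "\<dots> \<le> real n * real L * \<epsilon>\<^sup>2 / (20480 * d)" by (intro divide_right_mono nL) simp
    also have "\<dots> = real n * real L / (4 * R) * (\<epsilon>\<^sup>2 * real G / (16 * real d))"
      using G0 d by (simp add: R_def field_simps)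
    also have "\<dots> \<le> real N * (\<epsilon>\<^sup>2 * real G / (16 * real d))" by (intro mult_right_mono N) auto
    finally show ?thesis .
  qed
  have "card {r::bool list. length r = s} = 2 ^ s"
    using card_lists_length_eq[of "UNIV :: bool set" s] by simp
  then obtain num where num: "bij_betw num {r::bool list. length r = s} {..<(2::nat) ^ s}"
    using ex_bij_betw_finite_nat[OF finite_bit_strings[of s]] by (auto simp: lessThan_atLeast0)
  \<comment> \<open>The remaining \<open>s - 640 * h\<close> public bits become the factor
    \<open>H\<close>, so the 160 digits of a uniform string are exactly uniform.\<close>
  have H: "(4 ^ h * 4 ^ h) ^ 160 * 2 ^ (s - 640 * h) = (2::nat) ^ s"
  proof -
    have "(4::nat) ^ h = 2 ^ (2 * h)" by (simp add: power_mult)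
    then have "((4::nat) ^ h * 4 ^ h) ^ 160 * 2 ^ (s - 640 * h) = 2 ^ (640 * h + (s - 640 * h))"
      by (simp add: mult_2 flip: power_add power_mult)
    then show ?thesis using h by simp
  qed
  let ?P = "sign_protocol d L R N (\<lambda>r. row_coeff (4 ^ h) G (num r))"
  have "protocol_error d \<epsilon> n (\<lambda>_. 1) s ?P \<le> 1 / 10"
    unfolding R_def
    by (rule sign_protocol_error[OF _ G \<epsilon> D(1)[rule_format] D(2) _ H num N0]) (use L NR big in \<open>auto simp: R_def\<close>)
  then show "\<exists>P :: real protocol. is_protocol d n (\<lambda>_. 1) (\<lambda>_. L) s P \<and>
      protocol_error d \<epsilon> n (\<lambda>_. 1) s P \<le> 1 / 10"
    using is_protocol_sign_protocol by blast
qed auto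

end
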